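(* Let $K\ge1$, and let $u^{\{K\}}$ and $U^{\{K\}}$ be the continuum and the discrete global iterates after $K$ iterations of either the multiplicative or the additive overlapping Schwarz method (defined in the context). Let $u\in H^1_0(\Omega)$ satisfy $a(u,v)=l(v)$ for all $v\in H^1_0(\Omega)$, let $\psi\in L_2(\Omega)$, and let $\phi\in H^1_0(\Omega)$ be the solution of the global adjoint problem $a(v,\phi)=(\psi,v)$ for all $v\in H^1_0(\Omega)$. Then $$\left(u - u^{\{K\}}, \psi\right) = R \left(U^{\{K\}}, \phi\right) - \left(\psi, u^{\{K\}} - U^{\{K\}}\right),$$ where $R\left(U^{\{K\}},\phi\right)=l(\phi)-a\left(U^{\{K\}},\phi\right)$.
   Context: Problem. $\Omega$ is a bounded domain covered by $p$ overlapping open subdomains $\Omega_1,\dots,\Omega_p$: $\cup_i\Omega_i=\Omega$, and for every $i$ there is $j\neq i$ with $\Omega_i\cap\Omega_j\neq\emptyset$. $(\cdot,\cdot)$ is the $L_2(\Omega)$ inner product. $a(\cdot,\cdot)$ is the standard bilinear form of a second-order linear elliptic PDE, $a(u,v)=\int_\Omega (A\nabla u\cdot\nabla v+(\mathbf b\cdot\nabla u)v+c\,uv)\,dx$ with bounded measurable coefficients (for Poisson: $\int_\Omega\nabla u\cdot\nabla v\,dx$), and $l(v)=(f,v)$ with $f\in L_2(\Omega)$. $a_i$, $l_i$ are the restrictions of $a$, $l$ to $\Omega_i$. All variational problems are assumed uniquely solvable. Discretization. $\mathcal T_h$ is a conforming triangulation of $\Omega$ consistent with the decomposition (each $\overline{\Omega}_j$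 is a union of elements). $V_h\subset H^1_0(\Omega)$ is a space of continuous piecewise polynomials (of a fixed degree) on $\mathcal T_h$; $V_{i,h,0}\subset H^1_0(\Omega_i)$ is the corresponding space on $\mathcal T_h|_{\Omega_i}$ with functions vanishing on $\partial\Omega_i$. Both methods start from $u^{\{0\}}=U^{\{0\}}\in V_h$. Multiplicative Schwarz. For $k=0,\dots,K-1$ and $i=1,\dots,p$: $\widetilde u^{\{k+i/p\}}\in H^1(\Omega_i)$ satisfies $\widetilde u^{\{k+i/p\}}=u^{\{k+(i-1)/p\}}$ on $\partial\Omega_i$ and $a_i(\widetilde u^{\{k+i/p\}},v)=l_i(v)$ for all $v\in H^1_0(\Omega_i)$; then $u^{\{k+i/p\}}$ equals $\widetilde u^{\{k+i/p\}}$ on $\overline\Omega_i$ and $u^{\{k+(i-1)/p\}}$ on $\Omega\setminus\overline\Omega_i$ (with $k+p/p=k+1$). Additive Schwarz. $\tau$ is a real parameter. For $k=0,\dots,K-1$: for each $i$, $\widetilde u_i^{\{k+1\}}\in H^1(\Omega_i)$ satisfies $\widetilde u_i^{\{k+1\}}=u^{\{k\}}$ on $\partial\Omega_i$ and $a_i(\widetilde u_i^{\{k+1\}},v)=l_i(v)$ for all $v\in H^1_0(\Omega_i)$; then $u^{\{k+1\}}=(1-\tau p)u^{\{k\}}+\tau\sum_{i=1}^p\Pi_i\widetilde u_i^{\{k+1\}}$, where $\Pi_i\widetilde u_i^{\{k+1\}}$ equals $\widetilde u_i^{\{k+1\}}$ on $\overline\Omega_i$ and $u^{\{k\}}$ on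 $\Omega\setminus\overline\Omega_i$. In each case the discrete iterates $U^{\{\cdot\}}\in V_h$ are produced by the same method with $H^1(\Omega_i)$ replaced by continuous piecewise polynomials on $\mathcal T_h|_{\Omega_i}$ (with boundary values on $\partial\Omega_i$ given by the current discrete global iterate) and test space $H^1_0(\Omega_i)$ replaced by $V_{i,h,0}$. *)

theory Defs
  imports "HOL-Analysis.Analysis"
begin

section \<open>Lebesgue and Sobolev spaces on an open set\<close>

text \<open>
  Elements of $L_2(D)$, $H^1(D)$ and $H^1_0(D)$ are represented by total functions; only their
  values almost everywhere on \<open>D\<close> matter.
\<close>

definition L2 :: "(real^'n) set \<Rightarrow> (real^'n \<Rightarrow> 'b::euclidean_space) set" where
  "L2 D = {v. v \<in> borel_measurable (lebesgue_on D) \<and>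
              integrable (lebesgue_on D) (\<lambda>x. (norm (v x))\<^sup>2)}"

definition l2_inner ::
    "(real^'n) set \<Rightarrow> (real^'n \<Rightarrow> real) \<Rightarrow> (real^'n \<Rightarrow> real) \<Rightarrow> real" where
  "l2_inner D v w = (\<integral>x. v x * w x \<partial>(lebesgue_on D))"

definition partial_deriv :: "'n \<Rightarrow> (real^'n \<Rightarrow> real) \<Rightarrow> real^'n \<Rightarrow> real" where
  "partial_deriv i v x = frechet_derivative v (at x) (axis i 1)"

primrec C_k :: "nat \<Rightarrow> (real^'n \<Rightarrow> real) \<Rightarrow> bool" where
  "C_k 0 v \<longleftrightarrow> continuous_on UNIV v"
| "C_k (Suc k) v \<longleftrightarrow> (\<forall>x. v differentiable (at x)) \<and> (\<forall>i. C_k k (partial_deriv i v))"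

definition test_functions :: "(real^'n) set \<Rightarrow> (real^'n \<Rightarrow> real) set" where
  "test_functions D = {\<eta>. (\<forall>k. C_k k \<eta>) \<and>
     compact (closure {x. \<eta> x \<noteq> 0}) \<and> closure {x. \<eta> x \<noteq> 0} \<subseteq> D}"

definition is_weak_grad ::
    "(real^'n) set \<Rightarrow> (real^'n \<Rightarrow> real) \<Rightarrow> (real^'n \<Rightarrow> real^'n) \<Rightarrow> bool" where
  "is_weak_grad D v g \<longleftrightarrow> g \<in> L2 D \<and>
     (\<forall>\<eta>\<in>test_functions D. \<forall>i.
        (\<integral>x. v x * partial_deriv i \<eta> x \<partial>(lebesgue_on D)) =
        - (\<integral>x. g x $ i * \<eta> x \<partial>(lebesgue_on D)))"

definition H1 :: "(real^'n) set \<Rightarrow> (real^'n \<Rightarrow> real) set" where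
  "H1 D = {v \<in> L2 D. \<exists>g. is_weak_grad D v g}"

text \<open>The weak gradient is determined almost everywhere on \<open>D\<close>; this picks a representative.\<close>

definition weak_grad :: "(real^'n) set \<Rightarrow> (real^'n \<Rightarrow> real) \<Rightarrow> real^'n \<Rightarrow> real^'n" where
  "weak_grad D v = (SOME g. is_weak_grad D v g)"

definition H1_norm :: "(real^'n) set \<Rightarrow> (real^'n \<Rightarrow> real) \<Rightarrow> real" where
  "H1_norm D v = sqrt (\<integral>x. (v x)\<^sup>2 + (norm (weak_grad D v x))\<^sup>2 \<partial>(lebesgue_on D))"

text \<open>The closure of the test functions in $H^1(D)$.\<close>

definition H10 :: "(real^'n) set \<Rightarrow> (real^'n \<Rightarrow> real) set" where
  "H10 D = {v \<in> H1 D. \<forall>\<epsilon>>0. \<exists>\<eta>\<in>test_functions D. H1_norm D (\<lambda>x. v x - \<eta> x) < \<epsilon>}"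


section \<open>The elliptic problem\<close>

definition elliptic_coefficients ::
    "(real^'n) set \<Rightarrow> (real^'n \<Rightarrow> real^'n^'n) \<Rightarrow> (real^'n \<Rightarrow> real^'n) \<Rightarrow> (real^'n \<Rightarrow> real) \<Rightarrow> bool"
  where
  "elliptic_coefficients D A b c \<longleftrightarrow>
     A \<in> borel_measurable (lebesgue_on D) \<and> bounded (A ` D) \<and>
     b \<in> borel_measurable (lebesgue_on D) \<and> bounded (b ` D) \<and>
     c \<in> borel_measurable (lebesgue_on D) \<and> bounded (c ` D) \<and>
     (\<forall>x\<in>D. \<forall>\<xi>. \<xi> \<noteq> 0 \<longrightarrow> (A x *v \<xi>) \<bullet> \<xi> > 0)"

text \<open>
  The set argument \<open>D\<close> allows \<open>bilinear_form\<close> and \<open>load\<close> to serve both for the whole domain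
  and, by restriction of the integrals, for the subdomains.
\<close>

definition bilinear_form ::
    "(real^'n \<Rightarrow> real^'n^'n) \<Rightarrow> (real^'n \<Rightarrow> real^'n) \<Rightarrow> (real^'n \<Rightarrow> real) \<Rightarrow>
     (real^'n) set \<Rightarrow> (real^'n \<Rightarrow> real) \<Rightarrow> (real^'n \<Rightarrow> real) \<Rightarrow> real" where
  "bilinear_form A b c D u v =
     (\<integral>x. (A x *v weak_grad D u x) \<bullet> weak_grad D v x + (b x \<bullet> weak_grad D u x) * v x
            + c x * u x * v x \<partial>(lebesgue_on D))"

definition load :: "(real^'n \<Rightarrow> real) \<Rightarrow> (real^'n) set \<Rightarrow> (real^'n \<Rightarrow> real) \<Rightarrow> real" where
  "load f D v = l2_inner D f v"

definition residual ::
    "((real^'n \<Rightarrow> real) \<Rightarrow> (real^'n \<Rightarrow> real) \<Rightarrow> real) \<Rightarrow> ((real^'n \<Rightarrow> real) \<Rightarrow> real) \<Rightarrow>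
     (real^'n \<Rightarrow> real) \<Rightarrow> (real^'n \<Rightarrow> real) \<Rightarrow> real" where
  "residual a l U v = l v - a U v"

definition primal_solution ::
    "(real^'n) set \<Rightarrow> ((real^'n \<Rightarrow> real) \<Rightarrow> (real^'n \<Rightarrow> real) \<Rightarrow> real) \<Rightarrow>
     ((real^'n \<Rightarrow> real) \<Rightarrow> real) \<Rightarrow> (real^'n \<Rightarrow> real) \<Rightarrow> bool" where
  "primal_solution D a l u \<longleftrightarrow> u \<in> H10 D \<and> (\<forall>v\<in>H10 D. a u v = l v)"

definition adjoint_solution ::
    "(real^'n) set \<Rightarrow> ((real^'n \<Rightarrow> real) \<Rightarrow> (real^'n \<Rightarrow> real) \<Rightarrow> real) \<Rightarrow>
     (real^'n \<Rightarrow> real) \<Rightarrow> (real^'n \<Rightarrow> real) \<Rightarrow> bool" where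
  "adjoint_solution D a \<psi> \<phi> \<longleftrightarrow> \<phi> \<in> H10 D \<and> (\<forall>v\<in>H10 D. a v \<phi> = l2_inner D \<psi> v)"

text \<open>Uniqueness is equality as elements of $L_2(D)$.\<close>

definition uniquely_solvable ::
    "(real^'n) set \<Rightarrow> ((real^'n \<Rightarrow> real) \<Rightarrow> bool) \<Rightarrow> bool" where
  "uniquely_solvable D P \<longleftrightarrow>
     (\<exists>w. P w) \<and> (\<forall>w w'. P w \<longrightarrow> P w' \<longrightarrow> (AE x in lebesgue_on D. w x = w' x))"


section \<open>Finite elements\<close>

text \<open>
  The library notion \<^const>\<open>triangulation\<close> says that the simplices meet in common faces
  (conformity). That the open simplices lie in \<open>D\<close> makes \<open>\<T>\<close> a subdivision of \<open>D\<close> itself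
  and not just of its closure.
\<close>

definition triangulation_of :: "(real^'n) set set \<Rightarrow> (real^'n) set \<Rightarrow> bool" where
  "triangulation_of \<T> D \<longleftrightarrow> triangulation \<T> \<and>
     (\<forall>S\<in>\<T>. int CARD('n) simplex S \<and> interior S \<subseteq> D) \<and> \<Union>\<T> = closure D"

definition restrict_mesh :: "(real^'n) set set \<Rightarrow> (real^'n) set \<Rightarrow> (real^'n) set set" where
  "restrict_mesh \<T> D = {S\<in>\<T>. S \<subseteq> closure D}"

text \<open>Polynomials of total degree at most \<open>r\<close>; \<open>\<alpha>\<close> ranges over multi-indices.\<close>

definition polynomial_le :: "nat \<Rightarrow> (real^'n \<Rightarrow> real) \<Rightarrow> bool" where
  "polynomial_le r q \<longleftrightarrow>
     (\<exists>m. \<forall>x. q x = (\<Sum>\<alpha> | (\<Sum>i\<in>UNIV. \<alpha> i) \<le> r. m \<alpha> * (\<Prod>i\<in>UNIV. x $ i ^ \<alpha> i)))"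

definition fe_space ::
    "(real^'n) set set \<Rightarrow> nat \<Rightarrow> (real^'n) set \<Rightarrow> (real^'n \<Rightarrow> real) set" where
  "fe_space \<T> r D = {v. continuous_on (closure D) v \<and>
     (\<forall>S\<in>restrict_mesh \<T> D. \<exists>q. polynomial_le r q \<and> (\<forall>x\<in>S. v x = q x))}"

text \<open>
  For \<open>D\<close> the whole domain this is $V_h$, for \<open>D\<close> the \<open>i\<close>-th subdomain it is $V_{i,h,0}$.
  On a triangulated set, functions in \<open>fe_space\<close> that vanish on the frontier lie in \<open>H10\<close>;
  the membership records the inclusions $V_h \subset H^1_0$ and $V_{i,h,0} \subset H^1_0$.
\<close>

definition fe_space0 ::
    "(real^'n) set set \<Rightarrow> nat \<Rightarrow> (real^'n) set \<Rightarrow> (real^'n \<Rightarrow> real) set" where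
  "fe_space0 \<T> r D = {v \<in> fe_space \<T> r D. v \<in> H10 D \<and> (\<forall>x\<in>frontier D. v x = 0)}"


section \<open>Overlapping Schwarz methods\<close>

definition overlapping_cover :: "(real^'n) set \<Rightarrow> nat \<Rightarrow> (nat \<Rightarrow> (real^'n) set) \<Rightarrow> bool" where
  "overlapping_cover \<Omega> p \<Omega>s \<longleftrightarrow>
     (\<forall>i\<in>{1..p}. open (\<Omega>s i)) \<and> (\<Union>i\<in>{1..p}. \<Omega>s i) = \<Omega> \<and>
     (\<forall>i\<in>{1..p}. \<exists>j\<in>{1..p}. j \<noteq> i \<and> \<Omega>s i \<inter> \<Omega>s j \<noteq> {})"

text \<open>
  In the following, \<open>X D\<close> and \<open>X0 D\<close> are the trial and the test space on \<open>D\<close>, so that the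
  continuum method is obtained with \<^const>\<open>H1\<close>, \<^const>\<open>H10\<close> and the discrete one with
  \<open>fe_space \<T> r\<close>, \<open>fe_space0 \<T> r\<close>. The boundary condition $w = g$ on $\partial D$ is expressed
  by $w - g \in X_0(D)$, which is equality of traces in the first case and pointwise equality on
  the frontier in the second.
\<close>

definition local_solution ::
    "((real^'n) set \<Rightarrow> (real^'n \<Rightarrow> real) \<Rightarrow> (real^'n \<Rightarrow> real) \<Rightarrow> real) \<Rightarrow>
     ((real^'n) set \<Rightarrow> (real^'n \<Rightarrow> real) \<Rightarrow> real) \<Rightarrow>
     ((real^'n) set \<Rightarrow> (real^'n \<Rightarrow> real) set) \<Rightarrow> ((real^'n) set \<Rightarrow> (real^'n \<Rightarrow> real) set) \<Rightarrow>
     (real^'n) set \<Rightarrow> (real^'n \<Rightarrow> real) \<Rightarrow> (real^'n \<Rightarrow> real) \<Rightarrow> bool" where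
  "local_solution a l X X0 D g w \<longleftrightarrow>
     w \<in> X D \<and> (\<lambda>x. w x - g x) \<in> X0 D \<and> (\<forall>v\<in>X0 D. a D w v = l D v)"

definition glue ::
    "(real^'n) set \<Rightarrow> (real^'n \<Rightarrow> real) \<Rightarrow> (real^'n \<Rightarrow> real) \<Rightarrow> real^'n \<Rightarrow> real" where
  "glue D w g x = (if x \<in> closure D then w x else g x)"

text \<open>
  \<open>us k\<close> is the global iterate with superscript $k$, and \<open>s i\<close> the one with superscript $k + i/p$.
\<close>

definition multiplicative_schwarz ::
    "((real^'n) set \<Rightarrow> (real^'n \<Rightarrow> real) \<Rightarrow> (real^'n \<Rightarrow> real) \<Rightarrow> real) \<Rightarrow>
     ((real^'n) set \<Rightarrow> (real^'n \<Rightarrow> real) \<Rightarrow> real) \<Rightarrow>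
     ((real^'n) set \<Rightarrow> (real^'n \<Rightarrow> real) set) \<Rightarrow> ((real^'n) set \<Rightarrow> (real^'n \<Rightarrow> real) set) \<Rightarrow>
     nat \<Rightarrow> (nat \<Rightarrow> (real^'n) set) \<Rightarrow> nat \<Rightarrow> (real^'n \<Rightarrow> real) \<Rightarrow> (nat \<Rightarrow> real^'n \<Rightarrow> real) \<Rightarrow> bool"
  where
  "multiplicative_schwarz a l X X0 p \<Omega>s K u0 us \<longleftrightarrow> us 0 = u0 \<and>
     (\<forall>k<K. \<exists>s. s 0 = us k \<and>
        (\<forall>i\<in>{1..p}. \<exists>w. local_solution a l X X0 (\<Omega>s i) (s (i - 1)) w \<and>
                         s i = glue (\<Omega>s i) w (s (i - 1))) \<and>
        us (Suc k) = s p)"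

definition additive_schwarz ::
    "real \<Rightarrow> ((real^'n) set \<Rightarrow> (real^'n \<Rightarrow> real) \<Rightarrow> (real^'n \<Rightarrow> real) \<Rightarrow> real) \<Rightarrow>
     ((real^'n) set \<Rightarrow> (real^'n \<Rightarrow> real) \<Rightarrow> real) \<Rightarrow>
     ((real^'n) set \<Rightarrow> (real^'n \<Rightarrow> real) set) \<Rightarrow> ((real^'n) set \<Rightarrow> (real^'n \<Rightarrow> real) set) \<Rightarrow>
     nat \<Rightarrow> (nat \<Rightarrow> (real^'n) set) \<Rightarrow> nat \<Rightarrow> (real^'n \<Rightarrow> real) \<Rightarrow> (nat \<Rightarrow> real^'n \<Rightarrow> real) \<Rightarrow> bool"
  where
  "additive_schwarz \<tau> a l X X0 p \<Omega>s K u0 us \<longleftrightarrow> us 0 = u0 \<and>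
     (\<forall>k<K. \<exists>w.
        (\<forall>i\<in>{1..p}. local_solution a l X X0 (\<Omega>s i) (us k) (w i)) \<and>
        us (Suc k) =
          (\<lambda>x. (1 - \<tau> * real p) * us k x + \<tau> * (\<Sum>i=1..p. glue (\<Omega>s i) (w i) (us k) x)))"

end

theory Submission
  imports Defs
begin

text \<open>
The identity itself is short. Testing the primal problem with the adjoint solution and the adjoint
problem with the primal solution gives $l(\phi) = a(u, \phi) = (\psi, u)$. If moreover
$U^{\{K\}} \in H^1_0(\Omega)$, the adjoint problem gives $a(U^{\{K\}}, \phi) = (\psi, U^{\{K\}})$,
so the residual equals $(\psi, u) - (\psi, U^{\{K\}})$. If $u^{\{K\}} \in L_2(\Omega)$, the inner
products split, and inserting $u^{\{K\}}$ yields the claim. What carries the proof is therefore the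
regularity of the iterates, which are assembled by gluing.

For the continuum iterate square-integrability suffices. Gluing preserves it because the
frontier of a triangulated set is a null set (\<open>negligible_frontier_triangulated\<close>, \<open>glue_L2\<close>).

The discrete iterate has to stay in $H^1_0(\Omega)$. The local correction belongs to the test space
of the subdomain, hence to $H^1_0(\Omega_i)$, and it vanishes on $\partial\Omega_i$; gluing adds its
extension by zero (\<open>glue_H10\<close>). So the claim reduces to two facts: $H^1_0(\Omega)$ is a linear
space, and extension by zero maps $H^1_0(\Omega_i)$ into $H^1_0(\Omega)$ (\<open>zero_extension_H10\<close>).

Both facts depend on the weak gradient being unique almost everywhere, because the $H^1$ norm is
defined with an arbitrarily chosen weak gradient. Uniqueness is the fundamental lemma of the
calculus of variations (\<open>AE_zero_if_orthogonal_to_test_functions\<close>), for which smooth bump functions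
are constructed from $e^{-1/t}$. The extension by zero also uses that the classical gradient of a test
function is its weak gradient (\<open>test_function_is_weak_grad\<close>), that is, integration by parts.
\<close>

section \<open>Smooth bump functions on boxes\<close>

text \<open>
The functions $q(1/t)\,e^{-1/t}$, continued by $0$ to $t \le 0$. Keeping the polynomial \<open>q\<close> as a
parameter makes the family closed under differentiation, so that one computation of the first
derivative shows that all of its members are smooth.
\<close>

definition flat :: "real poly \<Rightarrow> real \<Rightarrow> real" where
  "flat q t = (if t > 0 then poly q (1 / t) * exp (- (1 / t)) else 0)"

definition flat_deriv :: "real poly \<Rightarrow> real poly" where
  "flat_deriv q = [:0, 0, 1:] * (q - pderiv q)"

lemma poly_times_exp_neg_tendsto_0: "((\<lambda>s. poly q s * exp (- s)) \<longlongrightarrow> (0::real)) at_top"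
proof -
  have "((\<lambda>s. \<Sum>i\<le>degree q. coeff q i * (s ^ i / exp s)) \<longlongrightarrow> (\<Sum>i\<le>degree q. coeff q i * 0)) at_top"
    by (intro tendsto_sum tendsto_mult tendsto_const tendsto_power_div_exp_0)
  moreover have "(\<lambda>s. \<Sum>i\<le>degree q. coeff q i * (s ^ i / exp s)) = (\<lambda>s. poly q s * exp (- s))"
    by (simp add: poly_altdef sum_distrib_right exp_minus divide_inverse mult.assoc)
  ultimately show ?thesis by simp
qed

text \<open>
At $t = 0$ the difference quotient from the right is $s\,q(s)\,e^{-s}$ with $s = 1/t$, and the
exponential beats every polynomial.
\<close>

lemma flat_has_derivative: "(flat q has_real_derivative flat (flat_deriv q) t) (at t)"
proof (cases t "0::real" rule: linorder_cases)
  case less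
  have "((\<lambda>_. 0) has_real_derivative 0) (at t)" by simp
  then have "(flat q has_real_derivative 0) (at t)"
    by (rule has_field_derivative_transform_within_open[where S = "{..<0}"])
      (use less in \<open>auto simp: flat_def\<close>)
  then show ?thesis using less by (simp add: flat_def)
next
  case greater
  have "((\<lambda>t. poly q (1 / t) * exp (- (1 / t))) has_real_derivative flat (flat_deriv q) t) (at t)"
    using greater
    by (auto intro!: derivative_eq_intros poly_DERIV[THEN DERIV_chain2]
        simp: flat_def flat_deriv_def field_simps power2_eq_square)
  then show ?thesis
    by (rule has_field_derivative_transform_within_open[where S = "{0<..}"])
      (use greater in \<open>auto simp: flat_def\<close>)
next
  case equal
  have "((\<lambda>s. poly (pCons 0 q) s * exp (- s)) \<longlongrightarrow> 0) at_top"
    by (rule poly_times_exp_neg_tendsto_0)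
  then have "((\<lambda>h. poly (pCons 0 q) (inverse h) * exp (- inverse h)) \<longlongrightarrow> 0) (at_right 0)"
    by (rule filterlim_compose[OF _ filterlim_inverse_at_top_right])
  then have r: "((\<lambda>h. (flat q (0 + h) - flat q 0) / h) \<longlongrightarrow> 0) (at_right 0)"
    by (rule Lim_transform_eventually)
      (auto simp: eventually_at_filter flat_def inverse_eq_divide)
  have "((\<lambda>h::real. 0) \<longlongrightarrow> (0::real)) (at_left 0)" by simp
  then have l: "((\<lambda>h. (flat q (0 + h) - flat q 0) / h) \<longlongrightarrow> 0) (at_left 0)"
    by (rule Lim_transform_eventually)
      (auto simp: eventually_at_filter flat_def)
  have "(flat q has_real_derivative 0) (at 0)"
    unfolding DERIV_def using l r by (simp add: filterlim_split_at)
  then show ?thesis by (simp add: equal flat_def)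
qed

lemma flat_one_bounds: "0 \<le> flat 1 t" "flat 1 t \<le> 1"
  by (auto simp: flat_def)

lemma flat_one_eq_0_iff: "flat 1 t = 0 \<longleftrightarrow> t \<le> 0"
  by (auto simp: flat_def)

lemma flat_one_dilation_tendsto_1:
  assumes "t > 0"
  shows "(\<lambda>k. flat 1 (real (Suc k) * t)) \<longlonglongrightarrow> 1"
proof -
  have "(\<lambda>k. exp (- (inverse (real (Suc k)) * (1 / t)))) \<longlonglongrightarrow> exp (- (0 * (1 / t)))"
    by (intro tendsto_intros LIMSEQ_inverse_real_of_nat)
  then show ?thesis using assms by (simp add: flat_def divide_simps)
qed

text \<open>
The algebra generated by the functions \<^const>\<open>flat\<close> of an affine function of one coordinate. It is
closed under partial derivatives by the sum and product rules, so all its members are smooth.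
\<close>

inductive flat_algebra :: "(real^'n \<Rightarrow> real) \<Rightarrow> bool" where
  const: "flat_algebra (\<lambda>x. m)"
| gen: "flat_algebra (\<lambda>x. flat q (\<alpha> * x $ i + \<beta>))"
| add: "flat_algebra v \<Longrightarrow> flat_algebra w \<Longrightarrow> flat_algebra (\<lambda>x. v x + w x)"
| mult: "flat_algebra v \<Longrightarrow> flat_algebra w \<Longrightarrow> flat_algebra (\<lambda>x. v x * w x)"

lemma flat_algebra_prod:
  "(\<And>j. j \<in> J \<Longrightarrow> flat_algebra (v j)) \<Longrightarrow> flat_algebra (\<lambda>x. \<Prod>j\<in>J. v j x)"
  by (induction J rule: infinite_finite_induct) (auto intro: flat_algebra.intros)

lemma partial_deriv_eqI:
  "(v has_derivative v') (at x) \<Longrightarrow> partial_deriv i v x = v' (axis i 1)"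
  unfolding partial_deriv_def using frechet_derivative_at by metis

lemma has_derivative_partial:
  assumes "v differentiable (at x)"
  shows "(v has_derivative frechet_derivative v (at x)) (at x)"
  using assms frechet_derivative_works by blast

lemma partial_deriv_add:
  assumes "v differentiable (at x)" "w differentiable (at x)"
  shows "partial_deriv i (\<lambda>x. v x + w x) x = partial_deriv i v x + partial_deriv i w x"
  by (rule partial_deriv_eqI[OF has_derivative_add[OF assms[THEN has_derivative_partial]],
        folded partial_deriv_def])

lemma partial_deriv_cmult:
  assumes "v differentiable (at x)"
  shows "partial_deriv i (\<lambda>x. m * v x) x = m * partial_deriv i v x"
  by (rule partial_deriv_eqI[OF has_derivative_mult_right[OF assms[THEN has_derivative_partial]],
        folded partial_deriv_def])

lemma partial_deriv_mult:
  assumes "v differentiable (at x)" "w differentiable (at x)"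
  shows "partial_deriv i (\<lambda>x. v x * w x) x = v x * partial_deriv i w x + partial_deriv i v x * w x"
  by (rule partial_deriv_eqI[OF has_derivative_mult[OF assms[THEN has_derivative_partial]],
        folded partial_deriv_def])

lemma flat_algebra_partial_deriv:
  fixes v :: "real^'n \<Rightarrow> real"
  assumes "flat_algebra v"
  shows "(\<forall>x. v differentiable (at x)) \<and> (\<forall>i. flat_algebra (partial_deriv i v))"
  using assms
proof induction
  case (const m)
  have "partial_deriv i (\<lambda>x::real^'n. m) = (\<lambda>x. 0)" for i
    by (rule ext, rule partial_deriv_eqI) (rule has_derivative_const)
  then show ?case by (simp add: flat_algebra.const)
next
  case (gen q \<alpha> j \<beta>)
  have D: "((\<lambda>x::real^'n. flat q (\<alpha> * x $ j + \<beta>)) has_derivative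
      (\<lambda>h. (\<alpha> * h $ j) * flat (flat_deriv q) (\<alpha> * x $ j + \<beta>))) (at x)" for x
  proof -
    have "((\<lambda>x::real^'n. \<alpha> * x $ j + \<beta>) has_derivative (\<lambda>h. \<alpha> * h $ j)) (at x)"
      by (auto intro!: derivative_eq_intros bounded_linear_vec_nth[THEN bounded_linear_imp_has_derivative])
    from DERIV_compose_FDERIV[OF flat_has_derivative this] show ?thesis .
  qed
  have "partial_deriv i (\<lambda>x::real^'n. flat q (\<alpha> * x $ j + \<beta>)) =
      (\<lambda>x. (\<alpha> * axis i 1 $ j) * flat (flat_deriv q) (\<alpha> * x $ j + \<beta>))" for i
    by (rule ext, rule partial_deriv_eqI[OF D])
  then show ?case
    using D by (auto simp: differentiable_def intro!: flat_algebra.intros)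
next
  case (add v w)
  then have "partial_deriv i (\<lambda>x. v x + w x) = (\<lambda>x. partial_deriv i v x + partial_deriv i w x)" for i
    by (auto simp: partial_deriv_add)
  with add show ?case by (auto intro: flat_algebra.intros)
next
  case (mult v w)
  then have "partial_deriv i (\<lambda>x. v x * w x) =
      (\<lambda>x. v x * partial_deriv i w x + partial_deriv i v x * w x)" for i
    by (auto simp: partial_deriv_mult)
  with mult show ?case by (auto intro!: flat_algebra.intros)
qed

lemma flat_algebra_imp_C_k: "flat_algebra v \<Longrightarrow> C_k k v"
proof (induction k arbitrary: v)
  case 0
  then have "\<forall>x. v differentiable (at x)" using flat_algebra_partial_deriv by blast
  then show ?case
    by (auto simp: continuous_on_eq_continuous_at intro: differentiable_imp_continuous_within)
qed (use flat_algebra_partial_deriv in auto)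

text \<open>
The dilation factor is \<open>Suc k\<close> and not \<open>k\<close>, so that every bump function is positive on the
whole box.
\<close>

definition box_bump :: "real^'n \<Rightarrow> real^'n \<Rightarrow> nat \<Rightarrow> real^'n \<Rightarrow> real" where
  "box_bump a b k x =
     (\<Prod>i\<in>UNIV. flat 1 (real (Suc k) * (x $ i - a $ i)) * flat 1 (real (Suc k) * (b $ i - x $ i)))"

lemma box_bump_bounds: "0 \<le> box_bump a b k x" "box_bump a b k x \<le> 1"
  unfolding box_bump_def
  by (auto intro!: prod_nonneg prod_le_1 mult_nonneg_nonneg mult_le_one simp: flat_one_bounds)

lemma box_bump_eq_0_iff: "box_bump a b k x = 0 \<longleftrightarrow> x \<notin> box a b"
  by (auto simp: box_bump_def flat_one_eq_0_iff mem_box_cart mult_le_0_iff not_less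
      simp del: of_nat_Suc)

lemma box_bump_tendsto_indicator: "(\<lambda>k. box_bump a b k x) \<longlonglongrightarrow> indicator (box a b) x"
proof (cases "x \<in> box a b")
  case True
  then have "(\<lambda>k. box_bump a b k x) \<longlonglongrightarrow> (\<Prod>i\<in>(UNIV::'a set). 1 * 1)"
    unfolding box_bump_def
    by (intro tendsto_prod tendsto_mult flat_one_dilation_tendsto_1) (auto simp: mem_box_cart)
  with True show ?thesis by simp
qed (simp add: box_bump_eq_0_iff[THEN iffD2])

lemma box_bump_test_function:
  assumes "cbox a b \<subseteq> D"
  shows "box_bump a b k \<in> test_functions D"
proof -
  have "flat_algebra (\<lambda>x. flat 1 (real (Suc k) * (x $ i - a $ i)) * flat 1 (real (Suc k) * (b $ i - x $ i)))"
    for i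
  proof -
    have eq: "(\<lambda>x. flat 1 (real (Suc k) * (x $ i - a $ i)) * flat 1 (real (Suc k) * (b $ i - x $ i))) =
      (\<lambda>x. flat 1 (real (Suc k) * x $ i + - (real (Suc k) * a $ i)) *
           flat 1 (- real (Suc k) * x $ i + real (Suc k) * b $ i))"
      by (simp add: algebra_simps)
    show ?thesis unfolding eq by (intro flat_algebra.intros)
  qed
  then have "flat_algebra (box_bump a b k)"
    unfolding box_bump_def[abs_def] by (intro flat_algebra_prod)
  moreover have "closure {x. box_bump a b k x \<noteq> 0} \<subseteq> cbox a b"
    by (rule closure_minimal) (use box_subset_cbox in \<open>auto simp: closed_cbox box_bump_eq_0_iff\<close>)
  ultimately show ?thesis
    using assms compact_cbox[of a b] closed_closure compact_Int_closed
    unfolding test_functions_def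
    by (auto simp: flat_algebra_imp_C_k intro: bounded_subset bounded_cbox simp: compact_eq_bounded_closed)
qed

section \<open>Functions whose integrals over boxes vanish\<close>

text \<open>
The sets over which the integral vanishes are closed under complements and disjoint countable
unions; the boxes are closed under intersection and generate the Borel sets. So the integral
vanishes over every Borel set.
\<close>

lemma AE_zero_if_box_integrals_zero:
  fixes h :: "'a::euclidean_space \<Rightarrow> real"
  assumes int: "integrable lborel h"
    and box: "\<And>a b. (\<integral>x. indicator (box a b) x * h x \<partial>lborel) = 0"
  shows "AE x in lborel. h x = 0"
proof (rule sigma_finite_measure.density_zero[OF lborel.sigma_finite_measure_axioms int])
  fix S :: "'a set" assume S: "S \<in> sets lborel"
  let ?G = "range (\<lambda>(a, b). box a b :: 'a set)"
  have G: "sets borel = sigma_sets UNIV ?G"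
    by (subst borel_eq_box) auto
  have si: "set_integrable lborel A h" if "A \<in> sets borel" for A
    using integrable_mult_indicator[OF _ int, of A] that by (simp add: set_integrable_def)
  have "Int_stable ?G"
    by (auto simp: Int_stable_def box_Int_box)
  moreover have "?G \<subseteq> Pow UNIV" by auto
  moreover have "S \<in> sigma_sets UNIV ?G" using S G by simp
  ultimately show "set_lebesgue_integral lborel S h = 0"
  proof (induction rule: sigma_sets_induct_disjoint)
    case (basic A)
    then show ?case using box by (auto simp: set_lebesgue_integral_def)
  next
    case empty
    show ?case by (simp add: set_lebesgue_integral_def)
  next
    case (compl A)
    have A: "A \<in> sets borel" using compl G by simp
    \<comment> \<open>For the complement, the integral over the whole space is needed; it is the limit of the
      integrals over growing boxes.\<close>
    let ?U = "\<lambda>n::nat. box (- (real n *\<^sub>R One)) (real n *\<^sub>R One) :: 'a set"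
    have "(\<lambda>n. \<integral>x. indicator (?U n) x * h x \<partial>lborel) \<longlonglongrightarrow> (\<integral>x. h x \<partial>lborel)"
    proof (rule integral_dominated_convergence[where w = "\<lambda>x. norm (h x)"])
      show "AE x in lborel. (\<lambda>n. indicator (?U n) x * h x) \<longlonglongrightarrow> h x"
      proof (rule AE_I2)
        fix x :: 'a
        obtain N where N: "x \<in> ?U N"
          using UN_box_eq_UNIV by blast
        have "x \<in> ?U n" if "n \<ge> N" for n
        proof -
          have "?U N \<subseteq> ?U n" using that by (auto simp: subset_box)
          with N show ?thesis by blast
        qed
        then have "\<forall>\<^sub>F n in sequentially. indicator (?U n) x * h x = h x"
          by (auto simp: eventually_sequentially intro!: exI[of _ N])
        then show "(\<lambda>n. indicator (?U n) x * h x) \<longlonglongrightarrow> h x"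
          by (rule tendsto_eventually)
      qed
    qed (use int in \<open>auto simp: indicator_def\<close>)
    then have "(\<integral>x. h x \<partial>lborel) = 0" using box by (simp add: LIMSEQ_const_iff)
    moreover have "set_lebesgue_integral lborel (UNIV - A) h =
        (\<integral>x. h x \<partial>lborel) - set_lebesgue_integral lborel A h"
      using set_integral_Un[of A "UNIV - A" lborel h] A si
      by (simp add: set_lebesgue_integral_def)
    ultimately show ?case using compl by simp
  next
    case (union A)
    have A: "A i \<in> sets borel" for i using union G by auto
    have "set_lebesgue_integral lborel (\<Union>i. A i) h = (\<Sum>i. set_lebesgue_integral lborel (A i) h)"
      by (rule lebesgue_integral_countable_add)
        (use A union in \<open>auto simp: disjoint_family_on_def intro!: si\<close>)
    then show ?case using union by simp
  qed
qed

section \<open>Square-integrable functions\<close>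

lemma open_lebesgue: "open D \<Longrightarrow> D \<in> sets lebesgue"
  by (auto intro!: sets_completionI_sets borel_open)

lemma L2D: "v \<in> L2 D \<Longrightarrow> v \<in> borel_measurable (lebesgue_on D)"
  "v \<in> L2 D \<Longrightarrow> integrable (lebesgue_on D) (\<lambda>x. (norm (v x))\<^sup>2)"
  by (auto simp: L2_def)

lemma L2_mult_integrable:
  fixes v w :: "real^'n \<Rightarrow> real"
  assumes "v \<in> L2 D" "w \<in> L2 D"
  shows "integrable (lebesgue_on D) (\<lambda>x. v x * w x)"
proof (rule Bochner_Integration.integrable_bound)
  show "integrable (lebesgue_on D) (\<lambda>x. (norm (v x))\<^sup>2 + (norm (w x))\<^sup>2)"
    using assms by (intro Bochner_Integration.integrable_add L2D)
  show "(\<lambda>x. v x * w x) \<in> borel_measurable (lebesgue_on D)"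
    using assms by (intro borel_measurable_times L2D)
  have "\<bar>a * b\<bar> \<le> a\<^sup>2 + b\<^sup>2" for a b :: real
    using sum_squares_bound[of "\<bar>a\<bar>" "\<bar>b\<bar>"] mult_nonneg_nonneg[OF abs_ge_zero abs_ge_zero, of a b]
    by (simp only: abs_mult power2_abs mult.assoc)
  then show "AE x in lebesgue_on D. norm (v x * w x) \<le> norm ((norm (v x))\<^sup>2 + (norm (w x))\<^sup>2)"
    by simp
qed

text \<open>
This replaces the triangle inequality of the $H^1$ norm: estimates with squared norms avoid square
roots of integrals.
\<close>

lemma norm_add_power2_le:
  fixes a b :: "'a::real_inner"
  shows "(norm (a + b))\<^sup>2 \<le> 2 * (norm a)\<^sup>2 + 2 * (norm b)\<^sup>2"
proof -
  have "(norm (a + b))\<^sup>2 + (norm (a - b))\<^sup>2 = 2 * (norm a)\<^sup>2 + 2 * (norm b)\<^sup>2"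
    by (simp add: power2_norm_eq_inner inner_simps inner_commute)
  then show ?thesis using zero_le_power2[of "norm (a - b)"] by linarith
qed

lemma L2_add:
  assumes "v \<in> L2 D" "w \<in> L2 D"
  shows "(\<lambda>x. v x + w x) \<in> L2 D"
proof -
  have meas: "(\<lambda>x. v x + w x) \<in> borel_measurable (lebesgue_on D)"
    using assms by (intro borel_measurable_add L2D)
  have "integrable (lebesgue_on D) (\<lambda>x. (norm (v x + w x))\<^sup>2)"
  proof (rule Bochner_Integration.integrable_bound)
    show "integrable (lebesgue_on D) (\<lambda>x. 2 * (norm (v x))\<^sup>2 + 2 * (norm (w x))\<^sup>2)"
      using assms by (intro Bochner_Integration.integrable_add integrable_mult_right L2D)
  qed (use meas norm_add_power2_le in auto)
  with meas show ?thesis by (simp add: L2_def)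
qed

lemma L2_scaleR:
  assumes "v \<in> L2 D"
  shows "(\<lambda>x. m *\<^sub>R v x) \<in> L2 D"
  using assms by (auto simp: L2_def power_mult_distrib intro: borel_measurable_scaleR)

lemma L2_diff:
  assumes "v \<in> L2 D" "w \<in> L2 D"
  shows "(\<lambda>x. v x - w x) \<in> L2 D"
  using L2_add[OF assms(1) L2_scaleR[OF assms(2), of "-1"]] by simp

lemma L2_component:
  assumes "g \<in> L2 D"
  shows "(\<lambda>x. g x $ i) \<in> L2 D"
proof -
  have meas: "(\<lambda>x. g x $ i) \<in> borel_measurable (lebesgue_on D)"
    using L2D(1)[OF assms]
    by (rule measurable_compose)
      (intro borel_measurable_continuous_onI continuous_intros)
  have "integrable (lebesgue_on D) (\<lambda>x. (norm (g x $ i))\<^sup>2)"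
  proof (rule Bochner_Integration.integrable_bound[OF L2D(2)[OF assms]])
    show "AE x in lebesgue_on D. norm ((norm (g x $ i))\<^sup>2) \<le> norm ((norm (g x))\<^sup>2)"
      using Finite_Cartesian_Product.norm_nth_le by (intro AE_I2) (auto intro!: power_mono)
  qed (use meas in auto)
  with meas show ?thesis by (simp add: L2_def)
qed

lemma L2_zero_extension_iff:
  assumes "S \<subseteq> D" "S \<in> sets lebesgue" "D \<in> sets lebesgue"
  shows "(\<lambda>x. if x \<in> S then v x else 0) \<in> L2 D \<longleftrightarrow> v \<in> L2 S"
proof -
  have eq: "indicat_real D x *\<^sub>R (norm (if x \<in> S then v x else 0))\<^sup>2 = indicat_real S x *\<^sub>R (norm (v x))\<^sup>2"
    for x using assms(1) by (auto simp: indicator_def)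
  show ?thesis
    using assms unfolding L2_def
    by (simp add: borel_measurable_if_lebesgue_on integrable_restrict_space eq del: real_scaleR_def)
qed

text \<open>
Lebesgue measure is complete, so a modification on a null set preserves measurability.
\<close>

lemma L2_cong_AE:
  assumes D: "D \<in> sets lebesgue" and v: "v \<in> L2 D" and eq: "AE x in lebesgue. x \<in> D \<longrightarrow> v x = w x"
  shows "w \<in> L2 D"
proof -
  have "(\<lambda>x. if x \<in> D then w x else 0) \<in> borel_measurable lebesgue"
    by (rule borel_measurable_AE[of "\<lambda>x. if x \<in> D then v x else 0"])
      (use assms in \<open>auto simp: borel_measurable_if L2_def\<close>)
  then have w: "w \<in> borel_measurable (lebesgue_on D)"
    using D by (simp add: borel_measurable_if)
  have "integrable (lebesgue_on D) (\<lambda>x. (norm (w x))\<^sup>2)"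
    by (rule integrable_cong_AE_imp[OF L2D(2)[OF v]])
      (use w D eq in \<open>auto simp: AE_restrict_space_iff\<close>)
  with w show ?thesis by (simp add: L2_def)
qed

lemma L2_subset:
  assumes "v \<in> L2 D" "S \<subseteq> D" "S \<in> sets lebesgue" "D \<in> sets lebesgue"
  shows "v \<in> L2 S"
proof -
  have "integrable lebesgue (\<lambda>x. indicat_real S x *\<^sub>R (indicat_real D x *\<^sub>R (norm (v x))\<^sup>2))"
    by (rule integrable_mult_indicator[OF assms(3)])
      (use L2D(2)[OF assms(1)] assms(4) in \<open>simp add: integrable_restrict_space\<close>)
  also have "(\<lambda>x. indicat_real S x *\<^sub>R (indicat_real D x *\<^sub>R (norm (v x))\<^sup>2)) =
      (\<lambda>x. indicat_real S x *\<^sub>R (norm (v x))\<^sup>2)"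
    using assms(2) by (auto simp: indicator_def fun_eq_iff)
  finally have "integrable lebesgue (\<lambda>x. indicat_real S x *\<^sub>R (norm (v x))\<^sup>2)" .
  moreover have "v \<in> borel_measurable (lebesgue_on S)"
    using measurable_restrict_mono[OF L2D(1)[OF assms(1)] assms(2)] .
  ultimately show ?thesis using assms by (simp add: L2_def integrable_restrict_space)
qed

lemma continuous_compact_support_L2:
  fixes v :: "real^'n \<Rightarrow> 'b::euclidean_space"
  assumes v: "continuous_on UNIV v" and K: "compact K" "\<And>x. x \<notin> K \<Longrightarrow> v x = 0"
    and D: "D \<in> sets lebesgue"
  shows "v \<in> L2 D"
proof -
  have meas: "v \<in> borel_measurable lebesgue"
    by (rule measurable_completion) (use borel_measurable_continuous_onI[OF v] in simp)
  have cont: "continuous_on UNIV (\<lambda>x. (norm (v x))\<^sup>2)"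
    by (intro continuous_on_power continuous_on_norm v)
  have "integrable lborel (\<lambda>x. indicat_real K x *\<^sub>R (norm (v x))\<^sup>2)"
    by (rule borel_integrable_compact[OF K(1)]) (rule continuous_on_subset[OF cont subset_UNIV])
  moreover have "(\<lambda>x. indicat_real K x *\<^sub>R (norm (v x))\<^sup>2) = (\<lambda>x. (norm (v x))\<^sup>2)"
    using K(2) by (auto simp: indicator_def fun_eq_iff)
  ultimately have "integrable lborel (\<lambda>x. (norm (v x))\<^sup>2)" by simp
  then have "integrable lebesgue (\<lambda>x. (norm (v x))\<^sup>2)"
    by (subst integrable_completion) (use borel_measurable_continuous_onI[OF cont] in simp_all)
  with meas have "v \<in> L2 UNIV" by (simp add: L2_def lebesgue_on_UNIV_eq)
  then show ?thesis using D by (auto intro: L2_subset)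
qed

section \<open>Test functions\<close>

lemma test_function_differentiable: "\<eta> \<in> test_functions D \<Longrightarrow> \<eta> differentiable (at x)"
  and test_function_continuous: "\<eta> \<in> test_functions D \<Longrightarrow> continuous_on UNIV \<eta>"
  and test_function_partial_continuous:
    "\<eta> \<in> test_functions D \<Longrightarrow> continuous_on UNIV (partial_deriv i \<eta>)"
proof -
  assume "\<eta> \<in> test_functions D"
  then have "C_k k \<eta>" for k by (simp add: test_functions_def)
  from this[of 0] this[of "Suc 0"]
  show "\<eta> differentiable (at x)" "continuous_on UNIV \<eta>" "continuous_on UNIV (partial_deriv i \<eta>)"
    by auto
qed

lemma test_function_support:
  assumes "\<eta> \<in> test_functions D"
  shows "compact (closure {x. \<eta> x \<noteq> 0})" "closure {x. \<eta> x \<noteq> 0} \<subseteq> D"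
    "\<And>x. x \<notin> closure {x. \<eta> x \<noteq> 0} \<Longrightarrow> \<eta> x = 0"
    "\<And>x i. x \<notin> closure {x. \<eta> x \<noteq> 0} \<Longrightarrow> partial_deriv i \<eta> x = 0"
proof -
  let ?K = "closure {x. \<eta> x \<noteq> 0}"
  show "compact ?K" "?K \<subseteq> D" using assms by (auto simp: test_functions_def)
  show zero: "\<eta> x = 0" if "x \<notin> ?K" for x
    using that closure_subset[of "{x. \<eta> x \<noteq> 0}"] by auto
  show "partial_deriv i \<eta> x = 0" if "x \<notin> ?K" for x i
  proof (rule partial_deriv_eqI)
    have "((\<lambda>_. 0) has_derivative (\<lambda>_. 0)) (at x)" by (rule has_derivative_const)
    then show "(\<eta> has_derivative (\<lambda>_. 0)) (at x)"
    proof (rule has_derivative_transform_within_open[OF _ open_Compl[OF closed_closure]])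
      show "x \<in> - ?K" using that by simp
      show "0 = \<eta> y" if "y \<in> - ?K" for y
        by (rule zero[symmetric]) (use that in simp)
    qed
  qed
qed

lemma test_functions_mono: "S \<subseteq> D \<Longrightarrow> test_functions S \<subseteq> test_functions D"
  by (auto simp: test_functions_def)

lemma C_k_add: "C_k k v \<Longrightarrow> C_k k w \<Longrightarrow> C_k k (\<lambda>x. v x + w x)"
proof (induction k arbitrary: v w)
  case (Suc k)
  then have "partial_deriv i (\<lambda>x. v x + w x) = (\<lambda>x. partial_deriv i v x + partial_deriv i w x)" for i
    by (auto simp: partial_deriv_add)
  with Suc show ?case by auto
qed (auto intro: continuous_intros)

lemma C_k_cmult: "C_k k v \<Longrightarrow> C_k k (\<lambda>x. m * v x)"
proof (induction k arbitrary: v)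
  case (Suc k)
  then have "partial_deriv i (\<lambda>x. m * v x) = (\<lambda>x. m * partial_deriv i v x)" for i
    by (auto simp: partial_deriv_cmult)
  with Suc show ?case by auto
qed (auto intro: continuous_intros)

lemma test_functions_add:
  assumes "\<eta> \<in> test_functions D" "\<zeta> \<in> test_functions D"
  shows "(\<lambda>x. \<eta> x + \<zeta> x) \<in> test_functions D"
proof -
  have sub: "closure {x. \<eta> x + \<zeta> x \<noteq> 0} \<subseteq> closure {x. \<eta> x \<noteq> 0} \<union> closure {x. \<zeta> x \<noteq> 0}"
    unfolding closure_Un[symmetric] by (rule closure_mono) auto
  have "bounded (closure {x. \<eta> x \<noteq> 0} \<union> closure {x. \<zeta> x \<noteq> 0})"
    using assms by (simp add: test_functions_def compact_eq_bounded_closed)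
  from bounded_subset[OF this sub] sub show ?thesis
    using assms by (auto simp: test_functions_def C_k_add compact_eq_bounded_closed)
qed

lemma test_functions_cmult:
  assumes "\<eta> \<in> test_functions D"
  shows "(\<lambda>x. m * \<eta> x) \<in> test_functions D"
proof -
  have sub: "closure {x. m * \<eta> x \<noteq> 0} \<subseteq> closure {x. \<eta> x \<noteq> 0}"
    by (rule closure_mono) auto
  have "bounded (closure {x. \<eta> x \<noteq> 0})"
    using assms by (simp add: test_functions_def compact_eq_bounded_closed)
  from bounded_subset[OF this sub] sub show ?thesis
    using assms by (auto simp: test_functions_def C_k_cmult compact_eq_bounded_closed)
qed

lemma test_function_L2:
  assumes "\<eta> \<in> test_functions D" "S \<in> sets lebesgue"
  shows "\<eta> \<in> L2 S" "partial_deriv i \<eta> \<in> L2 S"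
proof -
  note K = test_function_support[OF assms(1)]
  show "\<eta> \<in> L2 S"
    by (rule continuous_compact_support_L2[OF test_function_continuous[OF assms(1)] K(1,3) assms(2)])
  show "partial_deriv i \<eta> \<in> L2 S"
    by (rule continuous_compact_support_L2
        [OF test_function_partial_continuous[OF assms(1)] K(1,4) assms(2)])
qed

section \<open>The fundamental lemma of the calculus of variations\<close>

lemma L2_imp_integrable_cbox:
  fixes h :: "real^'n \<Rightarrow> real"
  assumes h: "h \<in> L2 D" and ab: "cbox a b \<subseteq> D" and D: "D \<in> sets lebesgue"
  shows "integrable (lebesgue_on (cbox a b)) h"
proof -
  have h': "h \<in> L2 (cbox a b)" using L2_subset[OF h ab _ D] by simp
  have "integrable lebesgue (indicat_real (cbox a b))"
    by (rule integrable_real_indicator) (auto simp: emeasure_lborel_cbox_eq)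
  then have one: "integrable (lebesgue_on (cbox a b)) (\<lambda>x. 1 :: real)"
    by (simp add: integrable_restrict_space)
  show ?thesis
  proof (rule Bochner_Integration.integrable_bound)
    show "integrable (lebesgue_on (cbox a b)) (\<lambda>x. 1 + (norm (h x))\<^sup>2)"
      using one L2D(2)[OF h'] by (rule Bochner_Integration.integrable_add)
    have "\<bar>t\<bar> \<le> \<bar>1 + t\<^sup>2\<bar>" for t :: real
      using sum_squares_bound[of 1 "\<bar>t\<bar>"] by simp
    then show "AE x in lebesgue_on (cbox a b). norm (h x) \<le> norm (1 + (norm (h x))\<^sup>2)"
      by (intro AE_I2) (simp only: real_norm_def power2_abs)
  qed (rule L2D(1)[OF h'])
qed

text \<open>
The fundamental lemma of the calculus of variations. The bump functions of a box are test functions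
that converge boundedly to its indicator function, so \<open>h\<close> has integral zero over every box whose
closure lies in \<open>D\<close>; countably many such boxes exhaust \<open>D\<close>.
\<close>

lemma AE_zero_if_orthogonal_to_test_functions:
  fixes h :: "real^'n \<Rightarrow> real"
  assumes D: "open D" and h: "h \<in> L2 D"
    and orth: "\<And>\<eta>. \<eta> \<in> test_functions D \<Longrightarrow> (\<integral>x. h x * \<eta> x \<partial>(lebesgue_on D)) = 0"
  shows "AE x in lebesgue_on D. h x = 0"
proof -
  note D' = open_lebesgue[OF D]
  have cbox: "AE x in lebesgue. x \<in> cbox a b \<longrightarrow> h x = 0" if ab: "cbox a b \<subseteq> D" for a b
  proof -
    define H where "H x = (if x \<in> box a b then h x else 0)" for x
    have "integrable lebesgue (\<lambda>x. indicat_real (cbox a b) x *\<^sub>R h x)"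
      using L2_imp_integrable_cbox[OF h ab D'] by (simp add: integrable_restrict_space)
    then have "integrable lebesgue (\<lambda>x. indicat_real (box a b) x *\<^sub>R (indicat_real (cbox a b) x *\<^sub>R h x))"
      by (rule integrable_mult_indicator[rotated]) simp
    also have "(\<lambda>x. indicat_real (box a b) x *\<^sub>R (indicat_real (cbox a b) x *\<^sub>R h x)) = H"
      using box_subset_cbox[of a b] by (auto simp: H_def indicator_def fun_eq_iff)
    finally have H: "integrable lebesgue H" .
    have vanish: "(\<integral>x. indicator (box c d) x * H x \<partial>lebesgue) = 0" for c d
    proof -
      \<comment> \<open>The bump functions of \<open>box a' b'\<close> need its closure inside \<open>D\<close>; that is why \<open>cbox a b\<close>
        and not \<open>box a b\<close> was assumed to be contained in \<open>D\<close>.\<close>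
      obtain a' b' where box': "box c d \<inter> box a b = box a' b'" and cbox': "cbox c d \<inter> cbox a b = cbox a' b'"
        using box_Int_box Int_interval by blast
      have "(\<lambda>k. \<integral>x. box_bump a' b' k x * H x \<partial>lebesgue) \<longlonglongrightarrow>
          (\<integral>x. indicator (box a' b') x * H x \<partial>lebesgue)"
      proof (rule integral_dominated_convergence[where w = "\<lambda>x. norm (H x)"])
        show "AE x in lebesgue. (\<lambda>k. box_bump a' b' k x * H x) \<longlonglongrightarrow> indicator (box a' b') x * H x"
          by (intro AE_I2 tendsto_mult box_bump_tendsto_indicator tendsto_const)
        fix k
        have "box_bump a' b' k \<in> test_functions UNIV" by (rule box_bump_test_function) simp
        then have "box_bump a' b' k \<in> borel_measurable lebesgue"
          using L2D(1)[OF test_function_L2(1), of _ UNIV UNIV] by (simp add: lebesgue_on_UNIV_eq)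
        then show "(\<lambda>x. box_bump a' b' k x * H x) \<in> borel_measurable lebesgue"
          using H by (intro borel_measurable_times) auto
        show "AE x in lebesgue. norm (box_bump a' b' k x * H x) \<le> norm (H x)"
          using box_bump_bounds[of a' b' k]
          by (intro AE_I2) (auto simp: abs_mult intro!: mult_left_le_one_le)
      qed (use H in \<open>auto intro!: borel_measurable_times borel_measurable_indicator open_lebesgue\<close>)
      moreover have "(\<integral>x. box_bump a' b' k x * H x \<partial>lebesgue) = 0" for k
      proof -
        have "box_bump a' b' k x * H x = (if x \<in> D then h x * box_bump a' b' k x else 0)" for x
        proof (cases "x \<in> box a' b'")
          case True
          then have "x \<in> box a b" using box' by blast
          moreover from this have "x \<in> D" using ab box_subset_cbox by blast
          ultimately show ?thesis by (simp add: H_def)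
        qed (simp add: box_bump_eq_0_iff[THEN iffD2])
        then have "(\<integral>x. box_bump a' b' k x * H x \<partial>lebesgue) =
            (\<integral>x. h x * box_bump a' b' k x \<partial>(lebesgue_on D))"
          by (simp add: Lebesgue_Measure.integral_restrict_UNIV[OF D'])
        also have "\<dots> = 0"
          using ab cbox' by (intro orth box_bump_test_function) blast
        finally show ?thesis .
      qed
      ultimately have "(\<integral>x. indicator (box a' b') x * H x \<partial>lebesgue) = 0"
        by (simp add: LIMSEQ_const_iff)
      moreover have "indicator (box a' b') x * H x = indicator (box c d) x * H x" for x
        unfolding box'[symmetric] by (simp add: H_def indicator_def)
      ultimately show ?thesis by simp
    qed
    \<comment> \<open>The generator argument works with Borel sets, so \<open>H\<close> is replaced by a Borel function
      that agrees with it almost everywhere.\<close>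
    obtain H' where H': "H' \<in> borel_measurable lborel" and eq: "AE x in lborel. H x = H' x"
      using completion_ex_borel_measurable_real[of H lborel] H by auto
    have eq': "AE x in lebesgue. H x = H' x" using eq by (rule AE_completion)
    have "integrable lebesgue H'"
      by (rule integrable_cong_AE_imp[OF H]) (use H' eq' in \<open>auto intro: measurable_completion\<close>)
    then have int: "integrable lborel H'" using H' integrable_completion by blast
    have "(\<integral>x. indicator (box c d) x * H' x \<partial>lborel) = 0" for c d
    proof -
      have "(\<integral>x. indicator (box c d) x * H' x \<partial>lborel) = (\<integral>x. indicator (box c d) x * H' x \<partial>lebesgue)"
        by (rule integral_completion[symmetric]) (use H' in auto)
      also have "\<dots> = (\<integral>x. indicator (box c d) x * H x \<partial>lebesgue)"
      proof (rule integral_cong_AE)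
        show "(\<lambda>x. indicator (box c d) x * H' x) \<in> borel_measurable lebesgue"
          using H' by (intro borel_measurable_times measurable_completion) auto
        show "(\<lambda>x. indicator (box c d) x * H x) \<in> borel_measurable lebesgue"
          using H by (auto intro!: borel_measurable_times borel_measurable_indicator open_lebesgue)
      qed (use eq' in auto)
      finally show ?thesis using vanish by simp
    qed
    from AE_completion[OF AE_zero_if_box_integrals_zero[OF int this]] eq'
    have "AE x in lebesgue. H x = 0" by eventually_elim simp
    moreover have "AE x in lebesgue. x \<notin> cbox a b - box a b"
      using negligible_frontier_interval[of a b]
      by (intro AE_not_in) (simp add: negligible_iff_null_sets)
    ultimately show ?thesis by eventually_elim (auto simp: H_def split: if_splits)
  qed
  obtain \<D> where \<D>: "countable \<D>" "\<D> \<subseteq> Pow D" "\<And>X. X \<in> \<D> \<Longrightarrow> \<exists>a b. X = cbox a b" "\<Union>\<D> = D"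
    using open_countable_Union_open_cbox[OF D] by blast
  have "AE x in lebesgue. x \<in> X \<longrightarrow> h x = 0" if "X \<in> \<D>" for X
    using \<D>(2,3) that cbox by blast
  then have "AE x in lebesgue. \<forall>X\<in>\<D>. x \<in> X \<longrightarrow> h x = 0"
    by (subst AE_ball_countable[OF \<D>(1)]) blast
  then show ?thesis
    using D' \<D>(4) by (auto simp: AE_restrict_space_iff)
qed

section \<open>Integration by parts\<close>

lemma directional_has_real_derivative:
  fixes v :: "real^'n \<Rightarrow> real"
  assumes "\<And>y. v differentiable (at y)"
  shows "((\<lambda>t. v (x + t *\<^sub>R axis i 1)) has_real_derivative partial_deriv i v (x + t *\<^sub>R axis i 1)) (at t)"
proof -
  let ?y = "x + t *\<^sub>R axis i 1"
  have lin: "linear (frechet_derivative v (at ?y))"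
    by (rule linear_frechet_derivative[OF assms])
  have "((\<lambda>t. x + t *\<^sub>R axis i 1) has_derivative (\<lambda>s. s *\<^sub>R axis i 1)) (at t)"
    by (auto intro!: derivative_eq_intros)
  from has_derivative_compose[OF this has_derivative_partial[OF assms]]
  have "((\<lambda>t. v (x + t *\<^sub>R axis i 1)) has_derivative
      (\<lambda>s. frechet_derivative v (at ?y) (s *\<^sub>R axis i 1))) (at t)" .
  moreover have "frechet_derivative v (at ?y) (s *\<^sub>R axis i 1) = partial_deriv i v ?y * s" for s
    by (simp add: partial_deriv_def linear_scale[OF lin])
  ultimately show ?thesis by (simp add: has_field_derivative_def)
qed

text \<open>
By translation invariance the difference quotients of \<open>v\<close> have integral zero. They converge to the
partial derivative, and by the mean value theorem they are bounded by its maximum and supported in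
a fixed ball, so dominated convergence applies.
\<close>

lemma integral_partial_deriv_eq_0:
  fixes v :: "real^'n \<Rightarrow> real"
  assumes diff: "\<And>x. v differentiable (at x)" and cont: "continuous_on UNIV (partial_deriv i v)"
    and K: "compact K" "\<And>x. x \<notin> K \<Longrightarrow> v x = 0" "\<And>x. x \<notin> K \<Longrightarrow> partial_deriv i v x = 0"
  shows "(\<integral>x. partial_deriv i v x \<partial>lborel) = 0"
proof -
  let ?e = "axis i 1 :: real^'n"
  define \<delta> where "\<delta> k = inverse (real (Suc k))" for k
  define d where "d k x = (v (x + \<delta> k *\<^sub>R ?e) - v x) / \<delta> k" for k x
  have \<delta>: "0 < \<delta> k" "\<delta> k \<le> 1" for k by (auto simp: \<delta>_def inverse_le_1_iff)
  have vcont: "continuous_on UNIV v"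
    using diff by (simp add: continuous_on_eq_continuous_at differentiable_imp_continuous_within)
  have vmeas: "v \<in> borel_measurable lborel"
    using borel_measurable_continuous_onI[OF vcont] by simp
  have shift_meas: "(\<lambda>x. v (x + y)) \<in> borel_measurable lborel" for y
  proof -
    have "continuous_on UNIV (\<lambda>x. v (x + y))"
      by (rule continuous_on_compose2[OF vcont]) (auto intro: continuous_intros)
    then show ?thesis using borel_measurable_continuous_onI by simp
  qed
  have vint: "integrable lborel v"
  proof -
    have "integrable lborel (\<lambda>x. indicat_real K x *\<^sub>R v x)"
      by (rule borel_integrable_compact[OF K(1)]) (rule continuous_on_subset[OF vcont subset_UNIV])
    also have "(\<lambda>x. indicat_real K x *\<^sub>R v x) = v"
      using K(2) by (auto simp: indicator_def fun_eq_iff)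
    finally show ?thesis .
  qed
  have shift: "integrable lborel (\<lambda>x. v (x + y))" "(\<integral>x. v (x + y) \<partial>lborel) = (\<integral>x. v x \<partial>lborel)" for y
  proof -
    have D: "distr lborel borel ((+) y) = lborel" by (rule lborel_distr_plus)
    have "integrable (distr lborel borel ((+) y)) v" "(\<integral>x. v x \<partial>distr lborel borel ((+) y)) = (\<integral>x. v x \<partial>lborel)"
      unfolding D by (simp_all add: vint)
    then show "integrable lborel (\<lambda>x. v (x + y))" "(\<integral>x. v (x + y) \<partial>lborel) = (\<integral>x. v x \<partial>lborel)"
      using vmeas by (simp_all add: integrable_distr_eq integral_distr add.commute)
  qed
  obtain M where M: "\<And>x. \<bar>partial_deriv i v x\<bar> \<le> M" "M \<ge> 0"
  proof -
    have "compact (partial_deriv i v ` K)"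
      by (rule compact_continuous_image[OF continuous_on_subset[OF cont subset_UNIV] K(1)])
    then have "bounded (partial_deriv i v ` K)" by (rule compact_imp_bounded)
    then obtain M where "M > 0" "\<And>x. x \<in> K \<Longrightarrow> \<bar>partial_deriv i v x\<bar> \<le> M"
      by (auto simp: bounded_pos)
    with that[of M] K(3) show ?thesis by force
  qed
  obtain R where "\<And>x. x \<in> K \<Longrightarrow> norm x \<le> R"
    using compact_imp_bounded[OF K(1)] by (auto simp: bounded_iff)
  then have R: "K \<subseteq> cball 0 R" by auto
  have bound: "\<bar>d k x\<bar> \<le> M * indicat_real (cball 0 (R + 1)) x" for k x
  proof (cases "x \<in> cball 0 (R + 1)")
    case True
    obtain t where "v (x + \<delta> k *\<^sub>R ?e) - v (x + 0 *\<^sub>R ?e) = (\<delta> k - 0) * partial_deriv i v (x + t *\<^sub>R ?e)"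
      using MVT2[OF \<delta>(1) directional_has_real_derivative[OF diff]] by blast
    then have "d k x = partial_deriv i v (x + t *\<^sub>R ?e)"
      using \<delta>(1)[of k] by (simp add: d_def)
    then show ?thesis using M(1) True by simp
  next
    case False
    have "norm x \<le> norm (x + \<delta> k *\<^sub>R ?e) + \<delta> k"
      using norm_triangle_ineq4[of "x + \<delta> k *\<^sub>R ?e" "\<delta> k *\<^sub>R ?e"] \<delta>(1)[of k] by simp
    with False \<delta>(2)[of k] have "R < norm (x + \<delta> k *\<^sub>R ?e)" by simp
    then have "x + \<delta> k *\<^sub>R ?e \<notin> K" using R by auto
    moreover have "x \<notin> K" using False R by auto
    ultimately show ?thesis using K(2) False by (simp add: d_def)
  qed
  have "(\<lambda>k. \<integral>x. d k x \<partial>lborel) \<longlonglongrightarrow> (\<integral>x. partial_deriv i v x \<partial>lborel)"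
  proof (rule integral_dominated_convergence[where w = "\<lambda>x. M * indicat_real (cball 0 (R + 1)) x"])
    show "partial_deriv i v \<in> borel_measurable lborel"
      using borel_measurable_continuous_onI[OF cont] by simp
    show "d k \<in> borel_measurable lborel" for k
      unfolding d_def[abs_def]
      by (intro borel_measurable_divide borel_measurable_diff shift_meas vmeas borel_measurable_const)
    show "integrable lborel (\<lambda>x. M * indicat_real (cball 0 (R + 1)) x)"
      by (intro integrable_mult_right integrable_real_indicator)
        (use emeasure_bounded_finite[OF bounded_cball] in simp_all)
    show "AE x in lborel. (\<lambda>k. d k x) \<longlonglongrightarrow> partial_deriv i v x"
    proof (rule AE_I2)
      fix x
      have "((\<lambda>h. (v (x + (0 + h) *\<^sub>R ?e) - v (x + 0 *\<^sub>R ?e)) / h) \<longlongrightarrow> partial_deriv i v (x + 0 *\<^sub>R ?e)) (at 0)"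
        using directional_has_real_derivative[OF diff] unfolding DERIV_def .
      moreover have "filterlim \<delta> (at 0) sequentially"
        using LIMSEQ_inverse_real_of_nat by (simp add: filterlim_at \<delta>_def[abs_def])
      ultimately have "(\<lambda>k. (v (x + (0 + \<delta> k) *\<^sub>R ?e) - v (x + 0 *\<^sub>R ?e)) / \<delta> k)
          \<longlonglongrightarrow> partial_deriv i v (x + 0 *\<^sub>R ?e)"
        by (rule filterlim_compose)
      then show "(\<lambda>k. d k x) \<longlonglongrightarrow> partial_deriv i v x" by (simp add: d_def)
    qed
    show "AE x in lborel. norm (d k x) \<le> M * indicat_real (cball 0 (R + 1)) x" for k
      using bound by simp
  qed
  moreover have "(\<integral>x. d k x \<partial>lborel) = 0" for k
    unfolding d_def using shift vint by simp
  ultimately show ?thesis by (simp add: LIMSEQ_const_iff)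
qed

definition grad :: "(real^'n \<Rightarrow> real) \<Rightarrow> real^'n \<Rightarrow> real^'n" where
  "grad v x = (\<chi> i. partial_deriv i v x)"

lemma grad_nth [simp]: "grad v x $ i = partial_deriv i v x"
  by (simp add: grad_def)

lemma grad_L2:
  assumes \<eta>: "\<eta> \<in> test_functions D" and S: "S \<in> sets lebesgue"
  shows "grad \<eta> \<in> L2 S"
proof -
  note K = test_function_support[OF \<eta>]
  show ?thesis
  proof (rule continuous_compact_support_L2[OF _ K(1) _ S])
    show "continuous_on UNIV (grad \<eta>)"
      unfolding grad_def[abs_def]
      by (intro continuous_on_vec_lambda test_function_partial_continuous[OF \<eta>])
    show "grad \<eta> x = 0" if "x \<notin> closure {x. \<eta> x \<noteq> 0}" for x
      using K(4)[OF that] by (simp add: vec_eq_iff)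
  qed
qed

text \<open>
Integration by parts: the integral of the partial derivative of \<open>\<eta> \<zeta>\<close> vanishes for every test
function \<open>\<zeta>\<close>.
\<close>

lemma test_function_is_weak_grad:
  assumes \<eta>: "\<eta> \<in> test_functions D" and D: "open D"
  shows "is_weak_grad D \<eta> (grad \<eta>)"
  unfolding is_weak_grad_def
proof (intro conjI ballI allI)
  note D' = open_lebesgue[OF D]
  show "grad \<eta> \<in> L2 D" by (rule grad_L2[OF \<eta> D'])
  fix \<zeta> i assume \<zeta>: "\<zeta> \<in> test_functions D"
  let ?p = "\<lambda>x. \<eta> x * \<zeta> x"
  note K = test_function_support[OF \<zeta>]
  have eq: "partial_deriv i ?p = (\<lambda>x. \<eta> x * partial_deriv i \<zeta> x + partial_deriv i \<eta> x * \<zeta> x)"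
    using partial_deriv_mult test_function_differentiable \<eta> \<zeta> by blast
  have cont: "continuous_on UNIV (partial_deriv i ?p)"
    unfolding eq by (intro continuous_on_add continuous_on_mult
        test_function_continuous[OF \<eta>] test_function_continuous[OF \<zeta>]
        test_function_partial_continuous[OF \<eta>] test_function_partial_continuous[OF \<zeta>])
  have "(\<integral>x. partial_deriv i ?p x \<partial>lborel) = 0"
  proof (rule integral_partial_deriv_eq_0[OF _ cont K(1)])
    show "?p differentiable (at x)" for x
      by (intro differentiable_mult test_function_differentiable[OF \<eta>]
          test_function_differentiable[OF \<zeta>])
    show "?p x = 0" "partial_deriv i ?p x = 0" if "x \<notin> closure {x. \<zeta> x \<noteq> 0}" for x
      using K(3,4)[OF that] by (simp_all add: eq)
  qed
  then have zero: "(\<integral>x. partial_deriv i ?p x \<partial>lebesgue) = 0"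
    using borel_measurable_continuous_onI[OF cont] by (simp add: integral_completion)
  have "partial_deriv i ?p = (\<lambda>x. if x \<in> D then partial_deriv i ?p x else 0)"
  proof
    fix x show "partial_deriv i ?p x = (if x \<in> D then partial_deriv i ?p x else 0)"
    proof (cases "x \<in> D")
      case False
      then have "x \<notin> closure {x. \<zeta> x \<noteq> 0}" using K(2) by blast
      from K(3,4)[OF this] False show ?thesis by (simp add: eq)
    qed simp
  qed
  from arg_cong[OF this, of "integral\<^sup>L lebesgue"] zero
  have "0 = (\<integral>x. (if x \<in> D then partial_deriv i ?p x else 0) \<partial>lebesgue)"
    by simp
  also have "\<dots> = (\<integral>x. \<eta> x * partial_deriv i \<zeta> x + partial_deriv i \<eta> x * \<zeta> x \<partial>lebesgue_on D)"
    by (simp add: Lebesgue_Measure.integral_restrict_UNIV[OF D'] eq)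
  also have "\<dots> = (\<integral>x. \<eta> x * partial_deriv i \<zeta> x \<partial>lebesgue_on D) +
      (\<integral>x. partial_deriv i \<eta> x * \<zeta> x \<partial>lebesgue_on D)"
    by (intro Bochner_Integration.integral_add L2_mult_integrable
        test_function_L2[OF \<eta> D'] test_function_L2[OF \<zeta> D'])
  finally show "(\<integral>x. \<eta> x * partial_deriv i \<zeta> x \<partial>lebesgue_on D) =
      - (\<integral>x. grad \<eta> x $ i * \<zeta> x \<partial>lebesgue_on D)"
    by simp
qed

section \<open>Weak gradients\<close>

lemma is_weak_gradD:
  assumes "is_weak_grad D v g"
  shows "g \<in> L2 D"
    "\<eta> \<in> test_functions D \<Longrightarrow>
      (\<integral>x. v x * partial_deriv i \<eta> x \<partial>(lebesgue_on D)) = - (\<integral>x. g x $ i * \<eta> x \<partial>(lebesgue_on D))"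
  using assms unfolding is_weak_grad_def by blast+

lemma is_weak_grad_add:
  assumes v: "v \<in> L2 D" "is_weak_grad D v g" and w: "w \<in> L2 D" "is_weak_grad D w g'"
    and D: "open D"
  shows "is_weak_grad D (\<lambda>x. v x + w x) (\<lambda>x. g x + g' x)"
  unfolding is_weak_grad_def
proof (intro conjI ballI allI)
  note gs = is_weak_gradD(1)[OF v(2)] is_weak_gradD(1)[OF w(2)]
  then show "(\<lambda>x. g x + g' x) \<in> L2 D" by (rule L2_add)
  fix \<eta> i assume \<eta>: "\<eta> \<in> test_functions D"
  note \<eta>' = test_function_L2[OF \<eta> open_lebesgue[OF D]]
  have "(\<integral>x. (v x + w x) * partial_deriv i \<eta> x \<partial>(lebesgue_on D)) =
      (\<integral>x. v x * partial_deriv i \<eta> x \<partial>(lebesgue_on D)) + (\<integral>x. w x * partial_deriv i \<eta> x \<partial>(lebesgue_on D))"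
    unfolding distrib_right
    by (intro Bochner_Integration.integral_add L2_mult_integrable v w \<eta>')
  moreover have "(\<integral>x. (g x + g' x) $ i * \<eta> x \<partial>(lebesgue_on D)) =
      (\<integral>x. g x $ i * \<eta> x \<partial>(lebesgue_on D)) + (\<integral>x. g' x $ i * \<eta> x \<partial>(lebesgue_on D))"
    unfolding distrib_right vector_add_component
    by (intro Bochner_Integration.integral_add L2_mult_integrable L2_component gs \<eta>')
  ultimately show "(\<integral>x. (v x + w x) * partial_deriv i \<eta> x \<partial>(lebesgue_on D)) =
        - (\<integral>x. (g x + g' x) $ i * \<eta> x \<partial>(lebesgue_on D))"
    using is_weak_gradD(2)[OF v(2) \<eta>, of i] is_weak_gradD(2)[OF w(2) \<eta>, of i] by simp
qed

lemma is_weak_grad_cmult: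
  assumes "is_weak_grad D v g"
  shows "is_weak_grad D (\<lambda>x. m * v x) (\<lambda>x. m *\<^sub>R g x)"
  using assms by (auto simp: is_weak_grad_def L2_scaleR mult.assoc)

text \<open>
\<^const>\<open>weak_grad\<close> is an arbitrary choice among the weak gradients. Uniqueness is what
makes $H^1$ norms computable from any weak gradient that happens to be known.
\<close>

lemma is_weak_grad_unique:
  assumes g: "is_weak_grad D v g" and g': "is_weak_grad D v g'" and D: "open D"
  shows "AE x in lebesgue_on D. g x = g' x"
proof -
  note gs = is_weak_gradD(1)[OF g] is_weak_gradD(1)[OF g']
  have "AE x in lebesgue_on D. g x $ i - g' x $ i = 0" for i
  proof (rule AE_zero_if_orthogonal_to_test_functions[OF D])
    show "(\<lambda>x. g x $ i - g' x $ i) \<in> L2 D" by (intro L2_diff L2_component gs)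
    fix \<eta> assume \<eta>: "\<eta> \<in> test_functions D"
    have "(\<integral>x. (g x $ i - g' x $ i) * \<eta> x \<partial>lebesgue_on D) =
        (\<integral>x. g x $ i * \<eta> x \<partial>lebesgue_on D) - (\<integral>x. g' x $ i * \<eta> x \<partial>lebesgue_on D)"
      unfolding left_diff_distrib
      by (intro Bochner_Integration.integral_diff L2_mult_integrable L2_component gs
          test_function_L2[OF \<eta> open_lebesgue[OF D]])
    also have "\<dots> = 0"
      using is_weak_gradD(2)[OF g \<eta>, of i] is_weak_gradD(2)[OF g' \<eta>, of i] by simp
    finally show "(\<integral>x. (g x $ i - g' x $ i) * \<eta> x \<partial>lebesgue_on D) = 0" .
  qed
  then have "AE x in lebesgue_on D. \<forall>i. g x $ i - g' x $ i = 0"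
    by (simp add: AE_all_countable)
  then show ?thesis by eventually_elim (simp add: vec_eq_iff)
qed

section \<open>The closure of the test functions\<close>

text \<open>
The squared $H^1$ norm, with the gradient as an explicit argument.
\<close>

definition H1_energy ::
    "(real^'n) set \<Rightarrow> (real^'n \<Rightarrow> real) \<Rightarrow> (real^'n \<Rightarrow> real^'n) \<Rightarrow> real" where
  "H1_energy D v g = (\<integral>x. (v x)\<^sup>2 + (norm (g x))\<^sup>2 \<partial>(lebesgue_on D))"

lemma H1_energy_integrable:
  assumes "v \<in> L2 D" "g \<in> L2 D"
  shows "integrable (lebesgue_on D) (\<lambda>x. (v x)\<^sup>2 + (norm (g x))\<^sup>2)"
  using L2D(2)[OF assms(1)] L2D(2)[OF assms(2)] by simp

lemma H1_energy_nonneg: "H1_energy D v g \<ge> 0"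
  unfolding H1_energy_def by simp

lemma H1_norm_eq_sqrt_energy:
  assumes g: "is_weak_grad D v g" and v: "v \<in> L2 D" and D: "open D"
  shows "H1_norm D v = sqrt (H1_energy D v g)"
proof -
  have wg: "is_weak_grad D v (weak_grad D v)"
    unfolding weak_grad_def using g by (rule someI[of "is_weak_grad D v"])
  then have L2: "weak_grad D v \<in> L2 D" "g \<in> L2 D" using g by (auto simp: is_weak_grad_def)
  have "(\<integral>x. (v x)\<^sup>2 + (norm (weak_grad D v x))\<^sup>2 \<partial>(lebesgue_on D)) = H1_energy D v g"
    unfolding H1_energy_def
    by (rule integral_cong_AE)
      (use H1_energy_integrable[OF v L2(1)] H1_energy_integrable[OF v L2(2)]
        is_weak_grad_unique[OF wg g D] in auto)
  then show ?thesis by (simp add: H1_norm_def)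
qed

definition H1_approximable ::
    "(real^'n) set \<Rightarrow> (real^'n \<Rightarrow> real) \<Rightarrow> (real^'n \<Rightarrow> real^'n) \<Rightarrow> bool" where
  "H1_approximable D v g \<longleftrightarrow>
     (\<forall>\<epsilon>>0. \<exists>\<eta>\<in>test_functions D. H1_energy D (\<lambda>x. v x - \<eta> x) (\<lambda>x. g x - grad \<eta> x) < \<epsilon>)"

text \<open>
Membership in $H^1_0$ without the chosen gradient: the approximation by test functions is measured
with an explicit weak gradient. All closure properties of $H^1_0$ below are proved in this form.
\<close>

lemma H10_iff:
  assumes D: "open D"
  shows "v \<in> H10 D \<longleftrightarrow> v \<in> L2 D \<and> (\<exists>g. is_weak_grad D v g \<and> H1_approximable D v g)"
proof -
  have norm: "H1_norm D (\<lambda>x. v x - \<eta> x) = sqrt (H1_energy D (\<lambda>x. v x - \<eta> x) (\<lambda>x. g x - grad \<eta> x))"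
    if v: "v \<in> L2 D" and g: "is_weak_grad D v g" and \<eta>: "\<eta> \<in> test_functions D" for g \<eta>
  proof (rule H1_norm_eq_sqrt_energy[OF _ _ D])
    have \<eta>': "\<eta> \<in> L2 D" by (rule test_function_L2[OF \<eta> open_lebesgue[OF D]])
    then show "(\<lambda>x. v x - \<eta> x) \<in> L2 D" by (rule L2_diff[OF v])
    have "is_weak_grad D (\<lambda>x. v x + (- 1) * \<eta> x) (\<lambda>x. g x + (- 1) *\<^sub>R grad \<eta> x)"
      using L2_scaleR[OF \<eta>', of "- 1"]
      by (intro is_weak_grad_add[OF v g _ _ D] is_weak_grad_cmult test_function_is_weak_grad[OF \<eta> D]) simp
    then show "is_weak_grad D (\<lambda>x. v x - \<eta> x) (\<lambda>x. g x - grad \<eta> x)" by simp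
  qed
  have "(\<forall>\<epsilon>>0. \<exists>\<eta>\<in>test_functions D. H1_norm D (\<lambda>x. v x - \<eta> x) < \<epsilon>) \<longleftrightarrow> H1_approximable D v g"
    if v: "v \<in> L2 D" and g: "is_weak_grad D v g" for g
  proof
    assume L: "\<forall>\<epsilon>>0. \<exists>\<eta>\<in>test_functions D. H1_norm D (\<lambda>x. v x - \<eta> x) < \<epsilon>"
    show "H1_approximable D v g"
      unfolding H1_approximable_def
    proof (intro allI impI)
      fix \<epsilon> :: real assume "\<epsilon> > 0"
      then obtain \<eta> where "\<eta> \<in> test_functions D" "H1_norm D (\<lambda>x. v x - \<eta> x) < sqrt \<epsilon>"
        using L[rule_format, of "sqrt \<epsilon>"] by auto
      then show "\<exists>\<eta>\<in>test_functions D. H1_energy D (\<lambda>x. v x - \<eta> x) (\<lambda>x. g x - grad \<eta> x) < \<epsilon>"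
        using norm[OF v g] by auto
    qed
  next
    assume R: "H1_approximable D v g"
    show "\<forall>\<epsilon>>0. \<exists>\<eta>\<in>test_functions D. H1_norm D (\<lambda>x. v x - \<eta> x) < \<epsilon>"
    proof (intro allI impI)
      fix \<epsilon> :: real assume \<epsilon>: "\<epsilon> > 0"
      then obtain \<eta> where \<eta>: "\<eta> \<in> test_functions D"
          "H1_energy D (\<lambda>x. v x - \<eta> x) (\<lambda>x. g x - grad \<eta> x) < \<epsilon>\<^sup>2"
        using R zero_less_power[OF \<epsilon>, of 2] unfolding H1_approximable_def by blast
      then have "H1_norm D (\<lambda>x. v x - \<eta> x) < \<epsilon>"
        using norm[OF v g \<eta>(1)] real_less_lsqrt \<epsilon> H1_energy_nonneg by simp
      with \<eta>(1) show "\<exists>\<eta>\<in>test_functions D. H1_norm D (\<lambda>x. v x - \<eta> x) < \<epsilon>" by blast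
    qed
  qed
  then show ?thesis unfolding H10_def H1_def by blast
qed

lemma H10_imp_L2: "v \<in> H10 D \<Longrightarrow> v \<in> L2 D"
  by (simp add: H10_def H1_def)

lemma H10_add:
  assumes D: "open D" and v: "v \<in> H10 D" and w: "w \<in> H10 D"
  shows "(\<lambda>x. v x + w x) \<in> H10 D"
proof -
  note D' = open_lebesgue[OF D]
  obtain g where g: "is_weak_grad D v g" "H1_approximable D v g"
    using v H10_iff[OF D] by blast
  obtain g' where g': "is_weak_grad D w g'" "H1_approximable D w g'"
    using w H10_iff[OF D] by blast
  have L2: "v \<in> L2 D" "w \<in> L2 D" "g \<in> L2 D" "g' \<in> L2 D"
    using v w g g' by (auto simp: H10_imp_L2 is_weak_grad_def)
  have "H1_approximable D (\<lambda>x. v x + w x) (\<lambda>x. g x + g' x)"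
    unfolding H1_approximable_def
  proof (intro allI impI)
    fix \<epsilon> :: real assume "\<epsilon> > 0"
    then have "\<epsilon> / 4 > 0" by simp
    then obtain \<eta> \<zeta> where \<eta>: "\<eta> \<in> test_functions D"
        "H1_energy D (\<lambda>x. v x - \<eta> x) (\<lambda>x. g x - grad \<eta> x) < \<epsilon> / 4"
      and \<zeta>: "\<zeta> \<in> test_functions D"
        "H1_energy D (\<lambda>x. w x - \<zeta> x) (\<lambda>x. g' x - grad \<zeta> x) < \<epsilon> / 4"
      using g(2) g'(2) unfolding H1_approximable_def by blast
    define \<xi> where "\<xi> x = \<eta> x + \<zeta> x" for x
    have \<xi>: "\<xi> \<in> test_functions D" unfolding \<xi>_def[abs_def] by (rule test_functions_add[OF \<eta>(1) \<zeta>(1)])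
    have grad: "grad \<xi> x = grad \<eta> x + grad \<zeta> x" for x
      using \<eta>(1) \<zeta>(1) unfolding \<xi>_def[abs_def]
      by (simp add: vec_eq_iff partial_deriv_add test_function_differentiable)
    note int = H1_energy_integrable[OF L2_diff[OF L2(1) test_function_L2(1)[OF \<eta>(1) D']]
          L2_diff[OF L2(3) grad_L2[OF \<eta>(1) D']]]
        H1_energy_integrable[OF L2_diff[OF L2(2) test_function_L2(1)[OF \<zeta>(1) D']]
          L2_diff[OF L2(4) grad_L2[OF \<zeta>(1) D']]]
    have pw: "(v x + w x - \<xi> x)\<^sup>2 + (norm (g x + g' x - grad \<xi> x))\<^sup>2 \<le>
        2 * ((v x - \<eta> x)\<^sup>2 + (norm (g x - grad \<eta> x))\<^sup>2) + 2 * ((w x - \<zeta> x)\<^sup>2 + (norm (g' x - grad \<zeta> x))\<^sup>2)" for x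
    proof -
      have e: "v x + w x - \<xi> x = (v x - \<eta> x) + (w x - \<zeta> x)"
        "g x + g' x - grad \<xi> x = (g x - grad \<eta> x) + (g' x - grad \<zeta> x)"
        by (simp_all add: \<xi>_def grad)
      show ?thesis
        unfolding e using norm_add_power2_le[of "v x - \<eta> x" "w x - \<zeta> x"]
          norm_add_power2_le[of "g x - grad \<eta> x" "g' x - grad \<zeta> x"]
        by simp
    qed
    have "H1_energy D (\<lambda>x. v x + w x - \<xi> x) (\<lambda>x. g x + g' x - grad \<xi> x) \<le>
        (\<integral>x. 2 * ((v x - \<eta> x)\<^sup>2 + (norm (g x - grad \<eta> x))\<^sup>2) +
          2 * ((w x - \<zeta> x)\<^sup>2 + (norm (g' x - grad \<zeta> x))\<^sup>2) \<partial>lebesgue_on D)"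
      unfolding H1_energy_def
      by (rule integral_mono)
        (intro H1_energy_integrable L2_diff L2_add L2 grad_L2[OF \<xi> D'] test_function_L2(1)[OF \<xi> D']
          Bochner_Integration.integrable_add integrable_mult_right int pw)+
    also have "\<dots> = 2 * H1_energy D (\<lambda>x. v x - \<eta> x) (\<lambda>x. g x - grad \<eta> x) +
        2 * H1_energy D (\<lambda>x. w x - \<zeta> x) (\<lambda>x. g' x - grad \<zeta> x)"
      unfolding H1_energy_def
      by (subst Bochner_Integration.integral_add) (intro integrable_mult_right int, intro integrable_mult_right int, simp only: integral_mult_right_zero)
    also have "\<dots> < \<epsilon>" using \<eta>(2) \<zeta>(2) by simp
    finally show "\<exists>\<eta>\<in>test_functions D.
        H1_energy D (\<lambda>x. v x + w x - \<eta> x) (\<lambda>x. g x + g' x - grad \<eta> x) < \<epsilon>"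
      using \<xi> by blast
  qed
  then show ?thesis
    using is_weak_grad_add[OF L2(1) g(1) L2(2) g'(1) D] L2_add[OF L2(1,2)] H10_iff[OF D] by blast
qed

lemma H10_cmult:
  assumes D: "open D" and v: "v \<in> H10 D"
  shows "(\<lambda>x. m * v x) \<in> H10 D"
proof -
  obtain g where g: "is_weak_grad D v g" "H1_approximable D v g"
    using v H10_iff[OF D] by blast
  have "H1_approximable D (\<lambda>x. m * v x) (\<lambda>x. m *\<^sub>R g x)"
    unfolding H1_approximable_def
  proof (intro allI impI)
    fix \<epsilon> :: real assume "\<epsilon> > 0"
    \<comment> \<open>The added 1 covers the case \<open>m = 0\<close>.\<close>
    moreover have pos: "m\<^sup>2 + 1 > 0" using zero_le_power2[of m] by linarith
    ultimately have "\<epsilon> / (m\<^sup>2 + 1) > 0" by simp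
    then obtain \<eta> where \<eta>: "\<eta> \<in> test_functions D"
        "H1_energy D (\<lambda>x. v x - \<eta> x) (\<lambda>x. g x - grad \<eta> x) < \<epsilon> / (m\<^sup>2 + 1)"
      using g(2) unfolding H1_approximable_def by blast
    have "grad (\<lambda>x. m * \<eta> x) x = m *\<^sub>R grad \<eta> x" for x
      using \<eta>(1) by (simp add: vec_eq_iff partial_deriv_cmult test_function_differentiable)
    then have "(m * v x - m * \<eta> x)\<^sup>2 + (norm (m *\<^sub>R g x - grad (\<lambda>x. m * \<eta> x) x))\<^sup>2 =
        m\<^sup>2 * ((v x - \<eta> x)\<^sup>2 + (norm (g x - grad \<eta> x))\<^sup>2)" for x
      by (simp add: distrib_left power_mult_distrib
          flip: right_diff_distrib scaleR_right_diff_distrib)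
    then have "H1_energy D (\<lambda>x. m * v x - m * \<eta> x) (\<lambda>x. m *\<^sub>R g x - grad (\<lambda>x. m * \<eta> x) x) =
        m\<^sup>2 * H1_energy D (\<lambda>x. v x - \<eta> x) (\<lambda>x. g x - grad \<eta> x)"
      by (simp add: H1_energy_def)
    also have "\<dots> \<le> (m\<^sup>2 + 1) * H1_energy D (\<lambda>x. v x - \<eta> x) (\<lambda>x. g x - grad \<eta> x)"
      using H1_energy_nonneg by (intro mult_right_mono) auto
    also have "\<dots> < \<epsilon>" using \<eta>(2) pos by (simp add: field_simps)
    finally show "\<exists>\<eta>\<in>test_functions D.
        H1_energy D (\<lambda>x. m * v x - \<eta> x) (\<lambda>x. m *\<^sub>R g x - grad \<eta> x) < \<epsilon>"
      by (rule bexI[OF _ test_functions_cmult[OF \<eta>(1)]])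
  qed
  then show ?thesis
    using is_weak_grad_cmult[OF g(1)] L2_scaleR[OF H10_imp_L2[OF v]] H10_iff[OF D] by auto
qed

section \<open>Extension by zero\<close>

text \<open>
It is used for functions as well as for their gradients, hence the general codomain.
\<close>

definition zero_extension :: "(real^'n) set \<Rightarrow> (real^'n \<Rightarrow> 'b::zero) \<Rightarrow> real^'n \<Rightarrow> 'b" where
  "zero_extension S v x = (if x \<in> S then v x else 0)"

text \<open>
The Cauchy-Schwarz inequality in the additive form $2|ab| \le a^2/\varepsilon + \varepsilon b^2$.
\<close>

lemma abs_integral_mult_le:
  fixes v w :: "real^'n \<Rightarrow> real"
  assumes "v \<in> L2 D" "w \<in> L2 D" "\<epsilon> > 0"
  shows "2 * \<bar>\<integral>x. v x * w x \<partial>(lebesgue_on D)\<bar> \<le>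
    (\<integral>x. (v x)\<^sup>2 \<partial>(lebesgue_on D)) / \<epsilon> + \<epsilon> * (\<integral>x. (w x)\<^sup>2 \<partial>(lebesgue_on D))"
proof -
  \<comment> \<open>Young's inequality, from $(|a| - \varepsilon |b|)^2 \ge 0$.\<close>
  have pw: "\<bar>a * b\<bar> \<le> (a\<^sup>2 / \<epsilon> + \<epsilon> * b\<^sup>2) / 2" for a b :: real
  proof -
    have "2 * (\<bar>a\<bar> * (\<epsilon> * \<bar>b\<bar>)) \<le> \<bar>a\<bar>\<^sup>2 + (\<epsilon> * \<bar>b\<bar>)\<^sup>2"
      using sum_squares_bound[of "\<bar>a\<bar>" "\<epsilon> * \<bar>b\<bar>"] by (simp only: mult.assoc)
    then show ?thesis
      using assms(3) by (simp add: abs_mult field_simps power2_eq_square)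
  qed
  have int: "integrable (lebesgue_on D) (\<lambda>x. (v x)\<^sup>2)" "integrable (lebesgue_on D) (\<lambda>x. (w x)\<^sup>2)"
    using L2D(2)[OF assms(1)] L2D(2)[OF assms(2)] by simp_all
  have "\<bar>\<integral>x. v x * w x \<partial>(lebesgue_on D)\<bar> \<le> (\<integral>x. \<bar>v x * w x\<bar> \<partial>(lebesgue_on D))"
    by (rule integral_abs_bound)
  also have "\<dots> \<le> (\<integral>x. ((v x)\<^sup>2 / \<epsilon> + \<epsilon> * (w x)\<^sup>2) / 2 \<partial>(lebesgue_on D))"
    by (rule integral_mono) (use int L2_mult_integrable[OF assms(1,2)] pw in auto)
  also have "\<dots> = ((\<integral>x. (v x)\<^sup>2 \<partial>(lebesgue_on D)) / \<epsilon> + \<epsilon> * (\<integral>x. (w x)\<^sup>2 \<partial>(lebesgue_on D))) / 2"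
    using int by simp
  finally show ?thesis by simp
qed

lemma integral_squares_le_H1_energy:
  assumes "v \<in> L2 D" "g \<in> L2 D"
  shows "(\<integral>x. (v x)\<^sup>2 \<partial>(lebesgue_on D)) \<le> H1_energy D v g"
    "(\<integral>x. (g x $ i)\<^sup>2 \<partial>(lebesgue_on D)) \<le> H1_energy D v g"
proof -
  have "(g x $ i)\<^sup>2 \<le> (v x)\<^sup>2 + (norm (g x))\<^sup>2" for x
    using power_mono[OF Finite_Cartesian_Product.norm_nth_le[of "g x" i], of 2]
    by (simp add: add_increasing)
  moreover have "integrable (lebesgue_on D) (\<lambda>x. (v x)\<^sup>2)" "integrable (lebesgue_on D) (\<lambda>x. (g x $ i)\<^sup>2)"
    using L2D(2)[OF assms(1)] L2D(2)[OF L2_component[OF assms(2)], of i] by simp_all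
  ultimately show "(\<integral>x. (v x)\<^sup>2 \<partial>(lebesgue_on D)) \<le> H1_energy D v g"
    "(\<integral>x. (g x $ i)\<^sup>2 \<partial>(lebesgue_on D)) \<le> H1_energy D v g"
    unfolding H1_energy_def
    by (auto intro!: integral_mono H1_energy_integrable assms)
qed

text \<open>
For a test function \<open>\<eta>\<close> of the smaller set, integration by parts against any test function of the
larger set leaves no boundary term, because \<open>\<eta>\<close> vanishes near the boundary. Both sides of the
identity are continuous in the $H^1$ norm, so it passes to limits of such \<open>\<eta>\<close>. For general
functions in $H^1$ the jump across the boundary would spoil it.
\<close>

lemma zero_extension_is_weak_grad:
  assumes v: "v \<in> L2 S" and g: "is_weak_grad S v g" and appr: "H1_approximable S v g"
    and S: "open S" and D: "open D" and sub: "S \<subseteq> D"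
  shows "is_weak_grad D (zero_extension S v) (zero_extension S g)"
  unfolding is_weak_grad_def
proof (intro conjI ballI allI)
  note S' = open_lebesgue[OF S] and D' = open_lebesgue[OF D]
  note gL2 = is_weak_gradD(1)[OF g]
  show "zero_extension S g \<in> L2 D"
    unfolding zero_extension_def[abs_def] using gL2 L2_zero_extension_iff[OF sub S' D'] by blast
  fix \<zeta> i assume \<zeta>: "\<zeta> \<in> test_functions D"
  note \<zeta>L2 = test_function_L2[OF \<zeta> S']
  \<comment> \<open>\<open>I\<close> is the defect in the identity that defines weak gradients.\<close>
  define I where "I = (\<integral>x. v x * partial_deriv i \<zeta> x \<partial>(lebesgue_on S)) +
      (\<integral>x. g x $ i * \<zeta> x \<partial>(lebesgue_on S))"
  define C where "C = (\<integral>x. (partial_deriv i \<zeta> x)\<^sup>2 \<partial>(lebesgue_on S)) +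
      (\<integral>x. (\<zeta> x)\<^sup>2 \<partial>(lebesgue_on S))"
  have bound: "2 * \<bar>I\<bar> \<le> (2 + C) * \<epsilon>" if \<epsilon>: "\<epsilon> > 0" for \<epsilon>
  proof -
    obtain \<eta> where \<eta>: "\<eta> \<in> test_functions S"
        "H1_energy S (\<lambda>x. v x - \<eta> x) (\<lambda>x. g x - grad \<eta> x) < \<epsilon>\<^sup>2"
      using appr zero_less_power[OF \<epsilon>, of 2] unfolding H1_approximable_def by blast
    note \<eta>L2 = test_function_L2[OF \<eta>(1) S'] grad_L2[OF \<eta>(1) S']
    note K = test_function_support[OF \<eta>(1)]
    have \<eta>D: "\<eta> \<in> test_functions D" using \<eta>(1) test_functions_mono[OF sub] by blast
    have restrict: "(\<integral>x. \<theta> x * w x \<partial>(lebesgue_on S)) = (\<integral>x. \<theta> x * w x \<partial>(lebesgue_on D))"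
      if "\<And>x. x \<notin> S \<Longrightarrow> \<theta> x = 0" for \<theta> w :: "real^'a \<Rightarrow> real"
    proof -
      have "(\<lambda>x. \<theta> x * w x) = (\<lambda>x. if x \<in> S then \<theta> x * w x else 0)"
        using that by auto
      then show ?thesis
        using Lebesgue_Measure.integral_restrict[OF sub S' D', of "\<lambda>x. \<theta> x * w x"] by simp
    qed
    have "(\<integral>x. \<eta> x * partial_deriv i \<zeta> x \<partial>(lebesgue_on S)) =
        (\<integral>x. \<eta> x * partial_deriv i \<zeta> x \<partial>(lebesgue_on D))"
      by (rule restrict) (use K(2,3) in blast)
    also have "\<dots> = - (\<integral>x. partial_deriv i \<eta> x * \<zeta> x \<partial>(lebesgue_on D))"
      using is_weak_gradD(2)[OF test_function_is_weak_grad[OF \<eta>D D] \<zeta>, of i] by simp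
    also have "(\<integral>x. partial_deriv i \<eta> x * \<zeta> x \<partial>(lebesgue_on D)) =
        (\<integral>x. partial_deriv i \<eta> x * \<zeta> x \<partial>(lebesgue_on S))"
      by (rule restrict[symmetric]) (use K(2,4) in blast)
    finally have parts: "(\<integral>x. \<eta> x * partial_deriv i \<zeta> x \<partial>(lebesgue_on S)) +
        (\<integral>x. partial_deriv i \<eta> x * \<zeta> x \<partial>(lebesgue_on S)) = 0"
      by simp
    have "(\<integral>x. (v x - \<eta> x) * partial_deriv i \<zeta> x \<partial>(lebesgue_on S)) =
        (\<integral>x. v x * partial_deriv i \<zeta> x \<partial>(lebesgue_on S)) - (\<integral>x. \<eta> x * partial_deriv i \<zeta> x \<partial>(lebesgue_on S))"
      unfolding left_diff_distrib
      by (intro Bochner_Integration.integral_diff L2_mult_integrable v \<eta>L2 \<zeta>L2)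
    moreover have "(\<integral>x. (g x - grad \<eta> x) $ i * \<zeta> x \<partial>(lebesgue_on S)) =
        (\<integral>x. g x $ i * \<zeta> x \<partial>(lebesgue_on S)) - (\<integral>x. partial_deriv i \<eta> x * \<zeta> x \<partial>(lebesgue_on S))"
      unfolding left_diff_distrib vector_minus_component grad_nth
      by (intro Bochner_Integration.integral_diff L2_mult_integrable L2_component gL2 \<eta>L2 \<zeta>L2)
    ultimately have I: "I = (\<integral>x. (v x - \<eta> x) * partial_deriv i \<zeta> x \<partial>(lebesgue_on S)) +
        (\<integral>x. (g x - grad \<eta> x) $ i * \<zeta> x \<partial>(lebesgue_on S))"
      using parts by (simp add: I_def)
    note d = L2_diff[OF v \<eta>L2(1)] L2_diff[OF gL2 \<eta>L2(3)]
    have sq: "(\<integral>x. (v x - \<eta> x)\<^sup>2 \<partial>(lebesgue_on S)) / \<epsilon> \<le> \<epsilon>"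
        "(\<integral>x. ((g x - grad \<eta> x) $ i)\<^sup>2 \<partial>(lebesgue_on S)) / \<epsilon> \<le> \<epsilon>"
      using integral_squares_le_H1_energy(1)[OF d] integral_squares_le_H1_energy(2)[OF d, of i] \<eta>(2) \<epsilon>
      by (simp_all add: pos_divide_le_eq power2_eq_square)
    show ?thesis
      using abs_integral_mult_le[OF d(1) \<zeta>L2(2)[of i] \<epsilon>]
        abs_integral_mult_le[OF L2_component[OF d(2)] \<zeta>L2(1) \<epsilon>, of i] sq
      by (simp add: I C_def algebra_simps abs_if split: if_splits)
  qed
  have "C \<ge> 0" by (simp add: C_def)
  have "I = 0"
  proof (rule ccontr)
    assume "I \<noteq> 0"
    \<comment> \<open>With this value of \<open>\<epsilon>\<close> the bound reads $2|I| \le |I|$.\<close>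
    then have "\<bar>I\<bar> / (2 + C) > 0" using \<open>C \<ge> 0\<close> by simp
    from bound[OF this] \<open>C \<ge> 0\<close> \<open>I \<noteq> 0\<close> show False by simp
  qed
  moreover have "(\<lambda>x. zero_extension S v x * partial_deriv i \<zeta> x) =
        (\<lambda>x. if x \<in> S then v x * partial_deriv i \<zeta> x else 0)"
      "(\<lambda>x. zero_extension S g x $ i * \<zeta> x) = (\<lambda>x. if x \<in> S then g x $ i * \<zeta> x else 0)"
    by (auto simp: zero_extension_def)
  ultimately show "(\<integral>x. zero_extension S v x * partial_deriv i \<zeta> x \<partial>(lebesgue_on D)) =
      - (\<integral>x. zero_extension S g x $ i * \<zeta> x \<partial>(lebesgue_on D))"
    by (simp add: I_def Lebesgue_Measure.integral_restrict[OF sub S' D'])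
qed

text \<open>
A sequence of test functions approximating \<open>v\<close> on \<open>S\<close> approximates its extension on \<open>D\<close>, at the same
distance.
\<close>

lemma zero_extension_H10:
  assumes v: "v \<in> H10 S" and S: "open S" and D: "open D" and sub: "S \<subseteq> D"
  shows "zero_extension S v \<in> H10 D"
proof -
  note S' = open_lebesgue[OF S] and D' = open_lebesgue[OF D]
  obtain g where g: "is_weak_grad S v g" "H1_approximable S v g"
    using v H10_iff[OF S] by blast
  have "H1_approximable D (zero_extension S v) (zero_extension S g)"
    unfolding H1_approximable_def
  proof (intro allI impI)
    fix \<epsilon> :: real assume "\<epsilon> > 0"
    then obtain \<eta> where \<eta>: "\<eta> \<in> test_functions S"
        "H1_energy S (\<lambda>x. v x - \<eta> x) (\<lambda>x. g x - grad \<eta> x) < \<epsilon>"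
      using g(2) unfolding H1_approximable_def by blast
    note K = test_function_support[OF \<eta>(1)]
    have "(zero_extension S v x - \<eta> x)\<^sup>2 + (norm (zero_extension S g x - grad \<eta> x))\<^sup>2 =
        (if x \<in> S then (v x - \<eta> x)\<^sup>2 + (norm (g x - grad \<eta> x))\<^sup>2 else 0)" for x
    proof (cases "x \<in> S")
      case False
      then have "x \<notin> closure {x. \<eta> x \<noteq> 0}" using K(2) by blast
      then have "\<eta> x = 0" "grad \<eta> x = 0"
        using K(3)[of x] K(4)[of x] by (auto simp only: vec_eq_iff grad_nth zero_index)
      with False show ?thesis by (simp add: zero_extension_def)
    qed (simp add: zero_extension_def)
    then have "H1_energy D (\<lambda>x. zero_extension S v x - \<eta> x) (\<lambda>x. zero_extension S g x - grad \<eta> x) =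
        H1_energy S (\<lambda>x. v x - \<eta> x) (\<lambda>x. g x - grad \<eta> x)"
      by (simp add: H1_energy_def Lebesgue_Measure.integral_restrict[OF sub S' D'])
    with \<eta> test_functions_mono[OF sub] show "\<exists>\<eta>\<in>test_functions D.
        H1_energy D (\<lambda>x. zero_extension S v x - \<eta> x) (\<lambda>x. zero_extension S g x - grad \<eta> x) < \<epsilon>"
      by (intro bexI[of _ \<eta>]) auto
  qed
  moreover have "zero_extension S v \<in> L2 D"
    unfolding zero_extension_def[abs_def]
    using H10_imp_L2[OF v] L2_zero_extension_iff[OF sub S' D'] by blast
  moreover have "is_weak_grad D (zero_extension S v) (zero_extension S g)"
    by (rule zero_extension_is_weak_grad[OF H10_imp_L2[OF v] g S D sub])
  ultimately show ?thesis using H10_iff[OF D] by blast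
qed

section \<open>Gluing\<close>

text \<open>
The open simplices lie in \<open>D\<close>, so its frontier is covered by the boundaries of finitely many
simplices.
\<close>

lemma negligible_frontier_triangulated:
  assumes T: "triangulation_of \<T> D" and D: "open D"
  shows "negligible (closure D - D)"
proof -
  have fin: "finite \<T>" and simplices: "\<And>S. S \<in> \<T> \<Longrightarrow> int CARD('a) simplex S"
    and int: "\<And>S. S \<in> \<T> \<Longrightarrow> interior S \<subseteq> D" and un: "\<Union>\<T> = closure D"
    using T by (auto simp: triangulation_of_def triangulation_def)
  have "negligible (\<Union>S\<in>\<T>. frontier S)"
    by (intro negligible_Union finite_imageI fin)
      (auto intro!: negligible_convex_frontier convex_convex_hull dest!: simplices simp: simplex)
  moreover have "closure D - D \<subseteq> (\<Union>S\<in>\<T>. frontier S)"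
  proof
    fix x assume x: "x \<in> closure D - D"
    then obtain S where S: "S \<in> \<T>" "x \<in> S" using un by blast
    then have "x \<notin> interior S" using int x by blast
    then have "x \<in> frontier S" using S(2) closure_subset by (auto simp: frontier_def)
    with S(1) show "x \<in> (\<Union>S\<in>\<T>. frontier S)" by blast
  qed
  ultimately show ?thesis by (rule negligible_subset)
qed

text \<open>
Gluing uses the values of \<open>w\<close> on the closure of \<open>S\<close>, but a function in $L_2(S)$ is unrestricted
on the frontier, where it may even fail to be measurable. A frontier of measure zero makes this
harmless.
\<close>

lemma glue_L2:
  assumes w: "w \<in> L2 S" and g: "g \<in> L2 D" and S: "open S" and D: "open D" and sub: "S \<subseteq> D"
    and null: "negligible (closure S - S)"
  shows "glue S w g \<in> L2 D"
proof -
  note S' = open_lebesgue[OF S] and D' = open_lebesgue[OF D]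
  have "(\<lambda>x. w x - g x) \<in> L2 S"
    by (rule L2_diff[OF w L2_subset[OF g sub S' D']])
  then have "(\<lambda>x. if x \<in> S then w x - g x else 0) \<in> L2 D"
    using L2_zero_extension_iff[OF sub S' D', of "\<lambda>x. w x - g x"] by simp
  from L2_add[OF g this] have "(\<lambda>x. g x + (if x \<in> S then w x - g x else 0)) \<in> L2 D" .
  then show ?thesis
  proof (rule L2_cong_AE[OF D'])
    have "AE x in lebesgue. x \<notin> closure S - S"
      using null by (intro AE_not_in) (simp add: negligible_iff_null_sets)
    then show "AE x in lebesgue. x \<in> D \<longrightarrow> g x + (if x \<in> S then w x - g x else 0) = glue S w g x"
    proof eventually_elim
      case (elim x)
      then show ?case using closure_subset[of S] by (auto simp: glue_def)
    qed
  qed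
qed

text \<open>
Gluing adds to \<open>g\<close> the extension by zero of the correction \<open>w - g\<close>. The correction has to vanish at
every point of the frontier, since gluing takes the closure of \<open>S\<close> and extension by zero takes \<open>S\<close>.
\<close>

lemma glue_H10:
  assumes g: "g \<in> H10 D" and diff: "(\<lambda>x. w x - g x) \<in> H10 S"
    and bdry: "\<And>x. x \<in> frontier S \<Longrightarrow> w x - g x = 0"
    and S: "open S" and D: "open D" and sub: "S \<subseteq> D"
  shows "glue S w g \<in> H10 D"
proof -
  have "glue S w g = (\<lambda>x. g x + zero_extension S (\<lambda>x. w x - g x) x)"
  proof
    fix x
    show "glue S w g x = g x + zero_extension S (\<lambda>x. w x - g x) x"
      using closure_subset[of S] bdry[of x] S
      by (auto simp: glue_def zero_extension_def frontier_def interior_open)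
  qed
  then show ?thesis
    using H10_add[OF D g zero_extension_H10[OF diff S D sub]] by simp
qed

section \<open>Schwarz iterates and the error representation\<close>

text \<open>
Only gluing changes an iterate, so a set of functions that is invariant under gluing with local
solutions is never left. It is applied with $L_2(\Omega)$ to the continuum method and with
$H^1_0(\Omega)$ to the discrete one.
\<close>

lemma multiplicative_schwarz_invariant:
  assumes sch: "multiplicative_schwarz a l X X0 p \<Omega>s K u0 us" and init: "u0 \<in> W"
    and step: "\<And>i g w. i \<in> {1..p} \<Longrightarrow> g \<in> W \<Longrightarrow> local_solution a l X X0 (\<Omega>s i) g w \<Longrightarrow>
      glue (\<Omega>s i) w g \<in> W"
  shows "k \<le> K \<Longrightarrow> us k \<in> W"
proof (induction k)
  case 0
  then show ?case using sch init by (simp add: multiplicative_schwarz_def)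
next
  case (Suc k)
  then have k: "k < K" "us k \<in> W" by simp_all
  with sch obtain s where s0: "s 0 = us k" and s: "\<forall>i\<in>{1..p}. \<exists>w. local_solution a l X X0 (\<Omega>s i) (s (i - 1)) w \<and>
      s i = glue (\<Omega>s i) w (s (i - 1))" and sp: "us (Suc k) = s p"
    unfolding multiplicative_schwarz_def by blast
  have "i \<le> p \<Longrightarrow> s i \<in> W" for i
  proof (induction i)
    case 0
    then show ?case using s0 k(2) by simp
  next
    case (Suc i)
    then have "Suc i \<in> {1..p}" by simp
    from s[rule_format, OF this] step[OF this] Suc show ?case by auto
  qed
  then show ?case using sp by simp
qed

text \<open>
The additive update combines the old iterate linearly with glued functions, so \<open>W\<close> has to be a linear space.
\<close>

lemma additive_schwarz_invariant:
  assumes sch: "additive_schwarz \<tau> a l X X0 p \<Omega>s K u0 us" and init: "u0 \<in> W"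
    and add: "\<And>v w. v \<in> W \<Longrightarrow> w \<in> W \<Longrightarrow> (\<lambda>x. v x + w x) \<in> W"
    and cmult: "\<And>m v. v \<in> W \<Longrightarrow> (\<lambda>x. m * v x) \<in> W"
    and step: "\<And>i g w. i \<in> {1..p} \<Longrightarrow> g \<in> W \<Longrightarrow> local_solution a l X X0 (\<Omega>s i) g w \<Longrightarrow>
      glue (\<Omega>s i) w g \<in> W"
  shows "k \<le> K \<Longrightarrow> us k \<in> W"
proof (induction k)
  case 0
  then show ?case using sch init by (simp add: additive_schwarz_def)
next
  case (Suc k)
  then have k: "k < K" "us k \<in> W" by simp_all
  with sch obtain w where w: "\<forall>i\<in>{1..p}. local_solution a l X X0 (\<Omega>s i) (us k) (w i)"
    and us: "us (Suc k) =
      (\<lambda>x. (1 - \<tau> * real p) * us k x + \<tau> * (\<Sum>i=1..p. glue (\<Omega>s i) (w i) (us k) x))"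
    unfolding additive_schwarz_def by blast
  have "J \<subseteq> {1..p} \<Longrightarrow> (\<lambda>x. \<Sum>i\<in>J. glue (\<Omega>s i) (w i) (us k) x) \<in> W" if "finite J" for J
    using that
  proof (induction J rule: finite_induct)
    case empty
    then show ?case using cmult[OF init, of 0] by simp
  next
    case (insert i J)
    then have "glue (\<Omega>s i) (w i) (us k) \<in> W" using step k(2) w by blast
    from add[OF this insert.IH] insert show ?case by simp
  qed
  from this[of "{1..p}"] show ?case
    unfolding us by (intro add cmult k(2)) auto
qed

theorem theorem2:
  fixes \<Omega> :: "(real^'n) set" and \<Omega>s :: "nat \<Rightarrow> (real^'n) set" and p r K :: nat
    and \<T> :: "(real^'n) set set"
    and A :: "real^'n \<Rightarrow> real^'n^'n" and b :: "real^'n \<Rightarrow> real^'n" and c :: "real^'n \<Rightarrow> real"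
    and f \<psi> u \<phi> U0 :: "real^'n \<Rightarrow> real" and us Us :: "nat \<Rightarrow> real^'n \<Rightarrow> real" and \<tau> :: real
  defines "a \<equiv> bilinear_form A b c" and "l \<equiv> load f"
  assumes domain: "open \<Omega>" "connected \<Omega>" "bounded \<Omega>" "\<Omega> \<noteq> {}"
    and cover: "overlapping_cover \<Omega> p \<Omega>s"
    and coefficients: "elliptic_coefficients \<Omega> A b c"
    and data: "f \<in> L2 \<Omega>" "\<psi> \<in> L2 \<Omega>"
    and mesh: "triangulation_of \<T> \<Omega>"
      "\<forall>i\<in>{1..p}. triangulation_of (restrict_mesh \<T> (\<Omega>s i)) (\<Omega>s i)"
    and solvable_global: "uniquely_solvable \<Omega> (primal_solution \<Omega> (a \<Omega>) (l \<Omega>))"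
      "uniquely_solvable \<Omega> (adjoint_solution \<Omega> (a \<Omega>) \<psi>)"
    and solvable_local:
      "\<forall>i\<in>{1..p}. \<forall>g\<in>H10 \<Omega>. uniquely_solvable (\<Omega>s i) (local_solution a l H1 H10 (\<Omega>s i) g)"
    and solvable_discrete:
      "\<forall>i\<in>{1..p}. \<forall>g\<in>fe_space0 \<T> r \<Omega>. uniquely_solvable (\<Omega>s i)
         (local_solution a l (fe_space \<T> r) (fe_space0 \<T> r) (\<Omega>s i) g)"
    and K: "K \<ge> 1"
    and initial: "U0 \<in> fe_space0 \<T> r \<Omega>"
    and iterates:
      "multiplicative_schwarz a l H1 H10 p \<Omega>s K U0 us \<and>
       multiplicative_schwarz a l (fe_space \<T> r) (fe_space0 \<T> r) p \<Omega>s K U0 Us \<or>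
       additive_schwarz \<tau> a l H1 H10 p \<Omega>s K U0 us \<and>
       additive_schwarz \<tau> a l (fe_space \<T> r) (fe_space0 \<T> r) p \<Omega>s K U0 Us"
    and primal: "primal_solution \<Omega> (a \<Omega>) (l \<Omega>) u"
    and adjoint: "adjoint_solution \<Omega> (a \<Omega>) \<psi> \<phi>"
  shows "l2_inner \<Omega> (\<lambda>x. u x - us K x) \<psi> =
    residual (a \<Omega>) (l \<Omega>) (Us K) \<phi> - l2_inner \<Omega> \<psi> (\<lambda>x. us K x - Us K x)"
proof -
  have op: "open (\<Omega>s i)" and sub: "\<Omega>s i \<subseteq> \<Omega>" if "i \<in> {1..p}" for i
    using cover that by (auto simp: overlapping_cover_def)
  have U0: "U0 \<in> H10 \<Omega>" using initial by (simp add: fe_space0_def)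
  have L2_step: "glue (\<Omega>s i) w g \<in> L2 \<Omega>"
    if "i \<in> {1..p}" "g \<in> L2 \<Omega>" "local_solution a l H1 H10 (\<Omega>s i) g w" for i g w
  proof (rule glue_L2[OF _ that(2) op[OF that(1)] domain(1) sub[OF that(1)]])
    show "w \<in> L2 (\<Omega>s i)" using that(3) by (simp add: local_solution_def H1_def)
    show "negligible (closure (\<Omega>s i) - \<Omega>s i)"
      using negligible_frontier_triangulated mesh(2) that(1) op by blast
  qed
  have "us K \<in> L2 \<Omega>"
    using iterates
  proof
    assume sch: "multiplicative_schwarz a l H1 H10 p \<Omega>s K U0 us \<and>
       multiplicative_schwarz a l (fe_space \<T> r) (fe_space0 \<T> r) p \<Omega>s K U0 Us"
    show ?thesis
      by (rule multiplicative_schwarz_invariant[OF conjunct1[OF sch] H10_imp_L2[OF U0] L2_step order_refl])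
  next
    assume sch: "additive_schwarz \<tau> a l H1 H10 p \<Omega>s K U0 us \<and>
       additive_schwarz \<tau> a l (fe_space \<T> r) (fe_space0 \<T> r) p \<Omega>s K U0 Us"
    show ?thesis
      by (rule additive_schwarz_invariant[OF conjunct1[OF sch] H10_imp_L2[OF U0] L2_add
            L2_scaleR[where 'b = real, unfolded real_scaleR_def] L2_step order_refl])
  qed
  have H10_step: "glue (\<Omega>s i) w g \<in> H10 \<Omega>"
    if "i \<in> {1..p}" "g \<in> H10 \<Omega>" "local_solution a l (fe_space \<T> r) (fe_space0 \<T> r) (\<Omega>s i) g w" for i g w
    using that(3) glue_H10[OF that(2) _ _ op[OF that(1)] domain(1) sub[OF that(1)], of w]
    by (simp add: local_solution_def fe_space0_def)
  have "Us K \<in> H10 \<Omega>"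
    using iterates
  proof
    assume sch: "multiplicative_schwarz a l H1 H10 p \<Omega>s K U0 us \<and>
       multiplicative_schwarz a l (fe_space \<T> r) (fe_space0 \<T> r) p \<Omega>s K U0 Us"
    show ?thesis
      by (rule multiplicative_schwarz_invariant[OF conjunct2[OF sch] U0 H10_step order_refl])
  next
    assume sch: "additive_schwarz \<tau> a l H1 H10 p \<Omega>s K U0 us \<and>
       additive_schwarz \<tau> a l (fe_space \<T> r) (fe_space0 \<T> r) p \<Omega>s K U0 Us"
    show ?thesis
      by (rule additive_schwarz_invariant[OF conjunct2[OF sch] U0 H10_add[OF domain(1)]
            H10_cmult[OF domain(1)] H10_step order_refl])
  qed
  have u: "u \<in> H10 \<Omega>" and \<phi>: "\<phi> \<in> H10 \<Omega>"
    using primal adjoint by (auto simp: primal_solution_def adjoint_solution_def)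
  have "l \<Omega> \<phi> = a \<Omega> u \<phi>"
    using primal \<phi> by (simp add: primal_solution_def)
  also have "\<dots> = l2_inner \<Omega> \<psi> u"
    using adjoint u by (simp add: adjoint_solution_def)
  finally have "l \<Omega> \<phi> = l2_inner \<Omega> \<psi> u" .
  moreover have "a \<Omega> (Us K) \<phi> = l2_inner \<Omega> \<psi> (Us K)"
    using adjoint \<open>Us K \<in> H10 \<Omega>\<close> by (simp add: adjoint_solution_def)
  moreover have "l2_inner \<Omega> (\<lambda>x. u x - us K x) \<psi> = l2_inner \<Omega> \<psi> u - l2_inner \<Omega> \<psi> (us K)"
    "l2_inner \<Omega> \<psi> (\<lambda>x. us K x - Us K x) = l2_inner \<Omega> \<psi> (us K) - l2_inner \<Omega> \<psi> (Us K)"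
    using L2_mult_integrable[OF data(2) H10_imp_L2[OF u]] L2_mult_integrable[OF data(2) \<open>us K \<in> L2 \<Omega>\<close>]
      L2_mult_integrable[OF data(2) H10_imp_L2[OF \<open>Us K \<in> H10 \<Omega>\<close>]]
    by (simp_all add: l2_inner_def right_diff_distrib mult.commute[of _ "\<psi> _"])
  ultimately show ?thesis by (simp add: residual_def)
qed

end
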